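(* There exists an absolute constant $c>0$ such that for every positive integer $m$, $$\lambda_3(m)\leq \lambda\bigl(C_{3,\,m+cm^{2/9}}\bigr).$$
   Context: A $3$-uniform hypergraph ($3$-graph) $G$ consists of a vertex set $V$ and an edge set $E\subseteq V^{(3)}$, where $V^{(3)}$ is the family of $3$-element subsets of $V$. For $G$ on vertex set $[n]=\{1,\dots,n\}$ and $\vec x=(x_1,\dots,x_n)\in\mathbb{R}^n$, the weight polynomial is $w(G,\vec x)=\sum_{e\in E}\prod_{i\in e}x_i$. A legal weighting is $\vec x$ with all $x_i\ge 0$ and $\sum_i x_i=1$. The Lagrangian of $G$ is $\lambda(G)=\max w(G,\vec x)$ over all legal weightings. Define $\lambda_3(m)=\max\{\lambda(H): H \text{ is a } 3\text{-graph with } m \text{ edges}\}$. The colexicographic order on $3$-subsets of $\mathbb{N}$: for distinct $A,B$, $A$ precedes $B$ if $\max(A\triangle B)\in B$. $C_{3,m}$ denotes the $3$-graph whose edges are the first $m$ sets of $\mathbb{N}^{(3)}$ in colexicographic order. *)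

theory Defs
  imports "HOL-Analysis.Analysis"
begin

type_synonym 'a hypergraph = "'a set \<times> 'a set set"

abbreviation verts :: "'a hypergraph \<Rightarrow> 'a set" where "verts \<equiv> fst"
abbreviation edges :: "'a hypergraph \<Rightarrow> 'a set set" where "edges \<equiv> snd"

definition three_graph :: "'a hypergraph \<Rightarrow> bool" where
  "three_graph G \<longleftrightarrow> finite (verts G) \<and> edges G \<subseteq> {e. e \<subseteq> verts G \<and> card e = 3}"

definition weight :: "'a hypergraph \<Rightarrow> ('a \<Rightarrow> real) \<Rightarrow> real" where
  "weight G x = (\<Sum>e\<in>edges G. \<Prod>i\<in>e. x i)"

text \<open>Values of a weighting outside the vertex set are left unconstrained; they do not
  influence the weight.\<close>

definition legal_weighting :: "'a hypergraph \<Rightarrow> ('a \<Rightarrow> real) \<Rightarrow> bool" where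
  "legal_weighting G x \<longleftrightarrow> (\<forall>i\<in>verts G. 0 \<le> x i) \<and> (\<Sum>i\<in>verts G. x i) = 1"

text \<open>The two suprema below are maxima, see \<open>lagrangian_attained\<close> and \<open>lambda3_attained\<close>.\<close>

definition lagrangian :: "'a hypergraph \<Rightarrow> real" where
  "lagrangian G = Sup {weight G x | x. legal_weighting G x}"

definition lambda3 :: "nat \<Rightarrow> real" where
  "lambda3 m = Sup {lagrangian H | H :: nat hypergraph. three_graph H \<and> card (edges H) = m}"

definition colex_less :: "nat set \<Rightarrow> nat set \<Rightarrow> bool" where
  "colex_less A B \<longleftrightarrow> A \<noteq> B \<and> Max (sym_diff A B) \<in> B"

text \<open>The natural numbers start at 1, as do the vertex sets \<open>{1..n}\<close>.\<close>

definition triples :: "nat set set" where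
  "triples = {A. A \<subseteq> {1..} \<and> card A = 3}"

text \<open>A triple is among the first \<open>m\<close> ones iff it has fewer than \<open>m\<close> predecessors
  (the set of predecessors is always finite, see \<open>finite_colex_predecessors\<close>).\<close>

definition colex_edges :: "nat \<Rightarrow> nat set set" where
  "colex_edges m = {A \<in> triples. card {B \<in> triples. colex_less B A} < m}"

definition colex_graph :: "nat \<Rightarrow> nat hypergraph" where
  "colex_graph m = (\<Union>(colex_edges m), colex_edges m)"


lemma three_graph_finite_edges: "three_graph G \<Longrightarrow> finite (edges G)"
  unfolding three_graph_def by (metis (no_types, lifting) Collect_mono finite_Collect_subsets finite_subset subset_trans)

lemma continuous_on_weight: "continuous_on S (weight G)"
  unfolding weight_def[abs_def]
  by (intro continuous_intros continuous_on_product_coordinates[THEN continuous_on_subset]) auto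

lemma lagrangian_attained:
  assumes G: "three_graph G" and ne: "verts G \<noteq> {}"
  shows "\<exists>x. legal_weighting G x \<and> weight G x = lagrangian G"
    and "legal_weighting G y \<Longrightarrow> weight G y \<le> lagrangian G"
proof -
  let ?V = "verts G"
  have fin: "finite ?V" using G by (simp add: three_graph_def)
  define P where "P = (PiE UNIV (\<lambda>i. if i \<in> ?V then {0..1::real} else {0}))"
  have "compactin (product_topology (\<lambda>i::'a. euclideanreal) UNIV) P"
    unfolding P_def by (subst compactin_PiE) auto
  hence cP: "compact P" by (simp add: euclidean_product_topology)
  define K where "K = P \<inter> {x. (\<Sum>i\<in>?V. x i) = 1}"
  have "closed {x::'a\<Rightarrow>real. (\<Sum>i\<in>?V. x i) = 1}"
    by (intro closed_Collect_eq continuous_intros continuous_on_product_coordinates[THEN continuous_on_subset]) auto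
  hence cK: "compact K" unfolding K_def using cP by (rule compact_Int_closed[rotated])
  obtain v where v: "v \<in> ?V" using ne by auto
  have "(\<lambda>i. if i = v then 1 else 0) \<in> K"
    using v fin by (auto simp: K_def P_def)
  hence "K \<noteq> {}" by auto
  from continuous_attains_sup[OF cK this continuous_on_weight[of _ G]]
  obtain x where x: "x \<in> K" and mx: "\<And>z. z \<in> K \<Longrightarrow> weight G z \<le> weight G x" by blast
  have lx: "legal_weighting G x"
    using x by (auto simp: K_def P_def legal_weighting_def PiE_iff split: if_splits)
  have ub: "weight G z \<le> weight G x" if z: "legal_weighting G z" for z
  proof -
    let ?z = "\<lambda>i. if i \<in> ?V then z i else 0"
    have "z i \<le> 1" if "i \<in> ?V" for i
      using member_le_sum[of i ?V z] that z fin by (auto simp: legal_weighting_def)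
    hence "?z \<in> K" using z by (auto simp: K_def P_def legal_weighting_def)
    moreover have "weight G ?z = weight G z"
      unfolding weight_def using G by (intro sum.cong prod.cong) (auto simp: three_graph_def)
    ultimately show ?thesis using mx by metis
  qed
  have eq: "lagrangian G = weight G x"
    unfolding lagrangian_def using lx ub by (intro cSup_eq_maximum) auto
  show "\<exists>x. legal_weighting G x \<and> weight G x = lagrangian G" using lx eq by auto
  show "legal_weighting G y \<Longrightarrow> weight G y \<le> lagrangian G" using ub eq by auto
qed

lemma lagrangian_le_embed:
  assumes G: "three_graph G" and H: "three_graph H" and f: "inj_on f (\<Union>(edges G))"
    and HG: "(`) f ` edges G = edges H" and ne: "edges G \<noteq> {}"
  shows "lagrangian G \<le> lagrangian H"
proof -
  let ?U = "\<Union>(edges G)"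
  have card3: "card e = 3" if "e \<in> edges G" for e using G that by (auto simp: three_graph_def)
  obtain e0 where e0: "e0 \<in> edges G" using ne by auto
  then obtain u where u: "u \<in> ?U" using card3[OF e0] by (cases "e0 = {}") auto
  have UV: "?U \<subseteq> verts G" using G by (auto simp: three_graph_def)
  have "f ` e \<subseteq> verts H" if "e \<in> edges G" for e
  proof -
    have "f ` e \<in> edges H" using that unfolding HG[symmetric] by blast
    thus ?thesis using H by (auto simp: three_graph_def)
  qed
  hence fUV: "f ` ?U \<subseteq> verts H" by blast
  have fV: "finite (verts G)" "finite (verts H)" using G H by (auto simp: three_graph_def)
  from UV fV(1) have fU: "finite ?U" by (rule finite_subset)
  from UV u have "verts G \<noteq> {}" by auto
  from lagrangian_attained(1)[OF G this] obtain x where x: "legal_weighting G x"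
    and wx: "weight G x = lagrangian G" by auto
  define r where "r = (\<Sum>i\<in>verts G - ?U. x i)"
  have r0: "r \<ge> 0" unfolding r_def using x by (intro sum_nonneg) (auto simp: legal_weighting_def)
  define g where "g = the_inv_into ?U f"
  have gf: "g (f i) = i" if "i \<in> ?U" for i unfolding g_def using f that by (rule the_inv_into_f_f)
  define y where "y j = (if j \<in> f ` ?U then x (g j) else 0) + (if j = f u then r else 0)" for j
  have x0: "x i \<ge> 0" if "i \<in> ?U" for i using x that UV by (auto simp: legal_weighting_def)
  have yx: "y (f i) \<ge> x i" if "i \<in> ?U" for i using that gf r0 by (auto simp: y_def)
  have "(\<Sum>j\<in>verts H. y j) = (\<Sum>j\<in>verts H. if j \<in> f ` ?U then x (g j) else 0) + r"
    unfolding y_def sum.distrib using fV u fUV by (auto simp: sum.delta)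
  also have "(\<Sum>j\<in>verts H. if j \<in> f ` ?U then x (g j) else 0) = (\<Sum>j\<in>f ` ?U. x (g j))"
    using fV fUV by (simp add: sum.inter_restrict[symmetric] Int_absorb1)
  also have "\<dots> = (\<Sum>i\<in>?U. x i)" using f by (subst sum.reindex) (auto simp: gf intro!: sum.cong)
  also have "\<dots> + r = (\<Sum>i\<in>verts G. x i)"
    unfolding r_def using sum.subset_diff[OF UV fV(1), of x] by simp
  also have "\<dots> = 1" using x by (simp add: legal_weighting_def)
  finally have s1: "(\<Sum>j\<in>verts H. y j) = 1" .
  have "x (g j) \<ge> 0" if "j \<in> f ` ?U" for j using that x0 gf by (metis imageE)
  hence "y j \<ge> 0" for j using r0 unfolding y_def by simp
  hence ly: "legal_weighting H y" using s1 by (auto simp: legal_weighting_def)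
  have inj: "inj_on ((`) f) (edges G)"
    by (rule inj_onI) (simp add: inj_on_image_eq_iff[OF f] Union_upper)
  have "weight H y = (\<Sum>e\<in>edges G. \<Prod>j\<in>f ` e. y j)"
    unfolding weight_def HG[symmetric] using inj by (subst sum.reindex) auto
  also have "\<dots> = (\<Sum>e\<in>edges G. \<Prod>i\<in>e. y (f i))"
    by (intro sum.cong refl, subst prod.reindex) (auto intro: inj_on_subset[OF f])
  finally have wy: "weight H y = (\<Sum>e\<in>edges G. \<Prod>i\<in>e. y (f i))" .
  have "weight G x \<le> weight H y"
    unfolding wy weight_def[of G] using x0 yx by (intro sum_mono prod_mono) blast
  hence "lagrangian G \<le> weight H y" using wx by simp
  also have "\<dots> \<le> lagrangian H"
    using lagrangian_attained(2)[OF H _ ly] u fUV by blast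
  finally show ?thesis .
qed

lemma finite_lagrangians:
  assumes "m > 0"
  shows "finite {lagrangian H | H :: nat hypergraph. three_graph H \<and> card (edges H) = m}"
proof (rule finite_subset)
  show "finite (lagrangian ` ({{..<3*m}} \<times> Pow (Pow {..<3*m})))" by simp
  show "{lagrangian H | H :: nat hypergraph. three_graph H \<and> card (edges H) = m}
    \<subseteq> lagrangian ` ({{..<3*m}} \<times> Pow (Pow {..<3*m}))"
  proof (rule subsetI)
    fix y assume "y \<in> {lagrangian H | H :: nat hypergraph. three_graph H \<and> card (edges H) = m}"
    then obtain V :: "nat set" and E where y: "y = lagrangian (V,E)"
      and G: "three_graph (V,E)" and m: "m = card (edges (V,E))" by auto
    let ?U = "\<Union>E"
    have fE: "finite E" using three_graph_finite_edges[OF G] by simp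
    have c3: "card e = 3" if "e \<in> E" for e using G that by (auto simp: three_graph_def)
    have fU: "finite ?U" using G by (auto simp: three_graph_def intro: finite_subset)
    have "card ?U \<le> (\<Sum>e\<in>E. card e)" by (rule card_Union_le_sum_card)
    also have "\<dots> = 3 * m" using c3 m by simp
    finally obtain f where f: "inj_on f ?U" "f ` ?U \<subseteq> {..<3*m}"
      using card_le_inj[OF fU finite_lessThan, of "3*m"] by (auto simp: image_subset_iff)
    define H where "H = ({..<3*m}, (`) f ` E)"
    have H: "three_graph H"
      using f c3 unfolding three_graph_def H_def
      by (auto simp: image_subset_iff) (subst card_image, auto intro: inj_on_subset)
    have ne: "E \<noteq> {}" using m assms by auto
    have 1: "lagrangian (V,E) \<le> lagrangian H"
      by (rule lagrangian_le_embed[OF G H, of f]) (use f ne in \<open>auto simp: H_def\<close>)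
    define g where "g = the_inv_into ?U f"
    have gf: "g (f i) = i" if "i \<in> ?U" for i unfolding g_def using f(1) that by (rule the_inv_into_f_f)
    have ge: "g ` f ` e = e" if "e \<in> E" for e
      using gf that by (force simp: image_image)
    have "inj_on g (f ` ?U)" by (rule inj_on_inverseI[of _ f]) (metis gf imageE)
    moreover have "\<Union>(edges H) = f ` ?U" by (auto simp: H_def)
    moreover have "(`) g ` edges H = E"
    proof -
      have "(`) g ` edges H = (\<lambda>e. g ` f ` e) ` E"
        by (simp only: H_def snd_conv image_image[of "(`) g"])
      also have "\<dots> = (\<lambda>e. e) ` E" by (rule image_cong[OF refl ge])
      finally show ?thesis by simp
    qed
    ultimately have 2: "lagrangian H \<le> lagrangian (V,E)"
      by (intro lagrangian_le_embed[OF H G, of g]) (use ne in \<open>auto simp: H_def\<close>)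
    have "lagrangian (V,E) = lagrangian H" using 1 2 by simp
    moreover have "H \<in> {{..<3*m}} \<times> Pow (Pow {..<3*m})" using f by (auto simp: H_def)
    ultimately show "y \<in> lagrangian ` ({{..<3*m}} \<times> Pow (Pow {..<3*m}))"
      unfolding y by (rule image_eqI)
  qed
qed

lemma colex_less_iff_set_encode:
  assumes "finite A" "finite B"
  shows "colex_less A B \<longleftrightarrow> set_encode A < set_encode B"
proof -
  have less: "set_encode A < set_encode B"
    if AB: "finite A" "finite B" and c: "colex_less A B" for A B
  proof -
    let ?k = "Max (sym_diff A B)"
    have fin: "finite (sym_diff A B)" using AB by auto
    have ne: "sym_diff A B \<noteq> {}" using c by (auto simp: colex_less_def)
    have k: "?k \<in> sym_diff A B" "?k \<in> B" using Max_in[OF fin ne] c by (auto simp: colex_less_def)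
    have "A - B \<subseteq> {..<?k}"
      using Max_ge[OF fin] k by (auto simp: le_less)
    hence "set_encode (A - B) \<le> (\<Sum>i<?k. 2 ^ i)"
      unfolding set_encode_def by (intro sum_mono2) auto
    also have "\<dots> < 2 ^ ?k" by (simp add: sum_power2 lessThan_atLeast0)
    also have "\<dots> \<le> set_encode (B - A)"
      unfolding set_encode_def using k AB by (intro member_le_sum) auto
    finally have "set_encode (A - B) < set_encode (B - A)" .
    moreover have "set_encode A = set_encode (A - B) + set_encode (A \<inter> B)"
      unfolding set_encode_def using AB by (metis add.commute sum.Int_Diff)
    moreover have "set_encode B = set_encode (B - A) + set_encode (A \<inter> B)"
      unfolding set_encode_def using AB by (metis add.commute inf_commute sum.Int_Diff)
    ultimately show ?thesis by simp
  qed
  show ?thesis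
  proof
    assume "set_encode A < set_encode B"
    hence AB: "A \<noteq> B" by auto
    have "Max (sym_diff A B) \<in> sym_diff A B" using AB assms by (intro Max_in) auto
    hence "colex_less A B \<or> colex_less B A"
      using AB by (auto simp: colex_less_def Un_commute)
    thus "colex_less A B" using less[OF assms(2,1)] \<open>set_encode A < set_encode B\<close> by auto
  qed (use less assms in auto)
qed

lemma finite_triple: "A \<in> triples \<Longrightarrow> finite A"
  by (auto simp: triples_def intro: card_ge_0_finite)

lemma finite_colex_predecessors:
  assumes "A \<in> triples"
  shows "finite {B \<in> triples. colex_less B A}"
proof (rule finite_imageD)
  have "set_encode ` {B \<in> triples. colex_less B A} \<subseteq> {..<set_encode A}"
    using assms by (auto simp: colex_less_iff_set_encode finite_triple)
  thus "finite (set_encode ` {B \<in> triples. colex_less B A})" using finite_subset by blast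
  show "inj_on set_encode {B \<in> triples. colex_less B A}"
    by (rule inj_on_subset[OF inj_on_set_encode]) (auto simp: finite_triple)
qed

lemma infinite_triples: "infinite triples"
proof -
  have "inj_on (\<lambda>n. {1, 2, n::nat}) {3..}"
  proof (rule inj_onI)
    fix a b :: nat assume "a \<in> {3..}" "b \<in> {3..}" "{1, 2, a} = {1, 2, b}"
    moreover from this(3) have "a \<in> {1, 2, b}" by blast
    ultimately show "a = b" by auto
  qed
  hence "infinite ((\<lambda>n. {1, 2, n::nat}) ` {3..})" using finite_imageD infinite_Ici by blast
  moreover have "(\<lambda>n. {1, 2, n::nat}) ` {3..} \<subseteq> triples" by (auto simp: triples_def)
  ultimately show ?thesis using finite_subset by blast
qed

lemma colex_edges_enumerate:
  "bij_betw set_encode (colex_edges m) (enumerate (set_encode ` triples) ` {..<m})"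
proof -
  let ?T = "set_encode ` triples"
  have inj: "inj_on set_encode triples"
    by (rule inj_on_subset[OF inj_on_set_encode]) (auto simp: finite_triple)
  have inf: "infinite ?T" using inj infinite_triples finite_imageD by blast
  have rank: "card {B \<in> triples. colex_less B A} = n"
    if A: "A \<in> triples" and n: "set_encode A = enumerate ?T n" for A n
  proof -
    have "card {B \<in> triples. colex_less B A} = card (set_encode ` {B \<in> triples. colex_less B A})"
      by (rule card_image[symmetric], rule inj_on_subset[OF inj]) auto
    also have "set_encode ` {B \<in> triples. colex_less B A} = {t \<in> ?T. t < enumerate ?T n}"
      using A by (auto simp: colex_less_iff_set_encode finite_triple n[symmetric])
    also have "\<dots> = enumerate ?T ` {..<n}"
      using inf by (auto simp: enumerate_in_set) (metis enumerate_Ex enumerate_mono_iff imageI lessThan_iff)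
    also have "card \<dots> = n"
      using inj_enumerate[OF inf] by (simp add: card_image inj_on_subset)
    finally show ?thesis .
  qed
  have "set_encode ` colex_edges m = enumerate ?T ` {..<m}"
  proof safe
    fix A assume A: "A \<in> colex_edges m"
    hence At: "A \<in> triples" by (simp add: colex_edges_def)
    obtain n where n: "set_encode A = enumerate ?T n" using enumerate_Ex[OF inf] At by (metis imageI)
    thus "set_encode A \<in> enumerate ?T ` {..<m}"
      using rank[OF At n] A by (auto simp: colex_edges_def)
  next
    fix n assume n: "n < m"
    obtain A where A: "A \<in> triples" "enumerate ?T n = set_encode A"
      using enumerate_in_set[OF inf, of n] by auto
    thus "enumerate ?T n \<in> set_encode ` colex_edges m"
      using rank[OF A(1) A(2)[symmetric]] n by (auto simp: colex_edges_def)
  qed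
  thus ?thesis unfolding bij_betw_def
    by (auto intro: inj_on_subset[OF inj] simp: colex_edges_def)
qed

lemma card_colex_edges: "card (colex_edges m) = m" and finite_colex_edges: "finite (colex_edges m)"
proof -
  have inj: "inj_on set_encode triples"
    by (rule inj_on_subset[OF inj_on_set_encode]) (auto simp: finite_triple)
  have "infinite (set_encode ` triples)" using inj infinite_triples finite_imageD by blast
  hence "inj (enumerate (set_encode ` triples))" by (rule inj_enumerate)
  hence "card (enumerate (set_encode ` triples) ` {..<m}) = m"
    by (subst card_image) (auto intro: inj_on_subset)
  thus "card (colex_edges m) = m" using bij_betw_same_card[OF colex_edges_enumerate] by metis
  show "finite (colex_edges m)" using bij_betw_finite[OF colex_edges_enumerate] by blast
qed

lemma three_graph_colex_graph: "three_graph (colex_graph m)"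
  using finite_colex_edges[of m]
  by (auto simp: three_graph_def colex_graph_def colex_edges_def finite_triple)
    (auto simp: triples_def)

lemma lambda3_attained:
  assumes "m > 0"
  shows "\<exists>H :: nat hypergraph. three_graph H \<and> card (edges H) = m \<and> lagrangian H = lambda3 m"
    and "\<And>H :: nat hypergraph. three_graph H \<Longrightarrow> card (edges H) = m \<Longrightarrow> lagrangian H \<le> lambda3 m"
proof -
  let ?S = "{lagrangian H | H :: nat hypergraph. three_graph H \<and> card (edges H) = m}"
  have fin: "finite ?S" by (rule finite_lagrangians[OF assms])
  have "lagrangian (colex_graph m) \<in> ?S"
    using three_graph_colex_graph card_colex_edges by (fastforce simp: colex_graph_def)
  hence ne: "?S \<noteq> {}" by blast
  have eq: "lambda3 m = Max ?S" unfolding lambda3_def using cSup_eq_Max[OF fin ne] .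
  show "\<exists>H :: nat hypergraph. three_graph H \<and> card (edges H) = m \<and> lagrangian H = lambda3 m"
  proof -
    have "lambda3 m \<in> ?S" using Max_in[OF fin ne] unfolding eq[symmetric] .
    then obtain H :: "nat hypergraph" where "lambda3 m = lagrangian H \<and> three_graph H \<and> card (edges H) = m"
      by (rule CollectE) blast
    thus ?thesis by (intro exI[of _ H]) simp
  qed
  show "\<And>H :: nat hypergraph. three_graph H \<Longrightarrow> card (edges H) = m \<Longrightarrow> lagrangian H \<le> lambda3 m"
    unfolding eq by (rule Max_ge[OF fin]) blast
qed

end

theory Submission
  imports Defs
begin

text \<open>
  Let \<open>T choose 3 < m \<le> (T + 1) choose 3\<close> and let \<open>x\<close> be an optimal weighting of an optimal graph,
  with support \<open>V\<close>, edges \<open>E\<close> inside \<open>V\<close> and set \<open>M\<close> of missing triples. One may assume that the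
  weight exceeds that of the clique on \<open>T\<close> vertices. As the link of every vertex has weight
  \<open>3 \<lambda>\<close>, all weights are at most \<open>3 / T\<close>, Cauchy--Schwarz makes every degree at least
  \<open>(T - 5)\<^sup>2 / 2\<close>, hence \<open>|V| < T + 12\<close>, and then only \<open>O(T)\<close> triples are missing. This
  forces \<open>|V| \<le> T + 1\<close>, and only \<open>|V| = T + 1\<close> is of interest.

  Let \<open>a\<close>, \<open>b\<close> be the two lightest vertices. Up to an error of \<open>O(T\<^bsup>2/3\<^esup>)\<close> triples, the missing
  triples weigh at least as much as the same number of triples \<open>{i, a, b}\<close> with \<open>i\<close> of average weight:
  replacing the two lighter vertices of a missing triple by \<open>a\<close>, \<open>b\<close> only decreases its
  weight, and the total deficit of the weights below \<open>1 / (T - 1)\<close> is bounded, so that few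
  triples can consist of vertices of large deficit. Hence a graph missing only
  \<open>|M| - O(T\<^bsup>2/3\<^esup>)\<close> triples \<open>{i, a, b}\<close>, which is a colex graph, has at least the same weight at \<open>x\<close>.
\<close>

section \<open>Elementary symmetric functions and link weights\<close>

definition esym :: "nat \<Rightarrow> 'a set \<Rightarrow> ('a \<Rightarrow> real) \<Rightarrow> real" where
  "esym k V x = (\<Sum>f | f \<subseteq> V \<and> card f = k. \<Prod>i\<in>f. x i)"

text \<open>The partial derivative with respect to \<open>x i\<close> of the polynomial of
  \<open>E\<close>.\<close>

definition link_weight :: "'a set set \<Rightarrow> ('a \<Rightarrow> real) \<Rightarrow> 'a \<Rightarrow> real" where
  "link_weight E x i = (\<Sum>f | f \<in> E \<and> i \<in> f. \<Prod>j\<in>f - {i}. x j)"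

lemma finite_ksubsets: "finite V \<Longrightarrow> finite {f. f \<subseteq> V \<and> card f = k}"
  by simp

lemma link_weight_ksubsets:
  assumes "finite V" "i \<in> V"
  shows "link_weight {f. f \<subseteq> V \<and> card f = Suc k} x i = esym k (V - {i}) x"
  unfolding link_weight_def esym_def
proof (rule sum.reindex_bij_witness[of _ "insert i" "\<lambda>f. f - {i}"])
  fix f assume "f \<in> {f. f \<in> {f. f \<subseteq> V \<and> card f = Suc k} \<and> i \<in> f}"
  thus "f - {i} \<in> {f. f \<subseteq> V - {i} \<and> card f = k}" by (auto simp: card_Diff_singleton_if)
next
  fix f assume f: "f \<in> {f. f \<subseteq> V - {i} \<and> card f = k}"
  hence "finite f" "i \<notin> f" using assms by (auto intro: finite_subset)
  thus "insert i f \<in> {f. f \<in> {f. f \<subseteq> V \<and> card f = Suc k} \<and> i \<in> f}" "insert i f - {i} = f"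
    using f assms by auto
qed auto

text \<open>The polynomial is multilinear, hence affine in \<open>x i\<close>. Both the recursion
  for \<open>esym\<close> and the perturbation argument rest on this.\<close>

lemma sum_split_link:
  assumes "finite E" "\<And>f. f \<in> E \<Longrightarrow> finite f"
  shows "(\<Sum>f\<in>E. \<Prod>j\<in>f. x j) = (\<Sum>f | f \<in> E \<and> i \<notin> f. \<Prod>j\<in>f. x j) + x i * link_weight E x i"
proof -
  have "(\<Sum>f\<in>E. \<Prod>j\<in>f. x j) = (\<Sum>f\<in>{f \<in> E. i \<notin> f} \<union> {f \<in> E. i \<in> f}. \<Prod>j\<in>f. x j)"
    by (intro sum.cong) auto
  also have "\<dots> = (\<Sum>f | f \<in> E \<and> i \<notin> f. \<Prod>j\<in>f. x j) + (\<Sum>f | f \<in> E \<and> i \<in> f. \<Prod>j\<in>f. x j)"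
    using assms(1) by (intro sum.union_disjoint) auto
  also have "(\<Sum>f | f \<in> E \<and> i \<in> f. \<Prod>j\<in>f. x j) = x i * link_weight E x i"
    unfolding link_weight_def sum_distrib_left using assms(2)
    by (intro sum.cong) (auto simp: prod.remove)
  finally show ?thesis .
qed

lemma esym_Suc_remove:
  assumes "finite V" "i \<in> V"
  shows "esym (Suc k) V x = esym (Suc k) (V - {i}) x + x i * esym k (V - {i}) x"
proof -
  have "{f. f \<in> {f. f \<subseteq> V \<and> card f = Suc k} \<and> i \<notin> f} = {f. f \<subseteq> V - {i} \<and> card f = Suc k}"
    by auto
  moreover have "finite f" if "f \<in> {f. f \<subseteq> V \<and> card f = Suc k}" for f
    using that assms(1) by (auto intro: finite_subset)
  ultimately show ?thesis
    using sum_split_link[of "{f. f \<subseteq> V \<and> card f = Suc k}" x i, OF finite_ksubsets[OF assms(1)]]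
    unfolding link_weight_ksubsets[OF assms, of k x] by (simp only: esym_def)
qed

lemma esym_Suc_insert:
  assumes "finite V" "i \<notin> V"
  shows "esym (Suc k) (insert i V) x = esym (Suc k) V x + x i * esym k V x"
  using esym_Suc_remove[of "insert i V" i k x] assms by simp

lemma esym_Suc_empty [simp]: "esym (Suc k) {} x = 0"
proof -
  have "{f. f \<subseteq> ({}::'a set) \<and> card f = Suc k} = {}" by auto
  thus ?thesis unfolding esym_def by simp
qed

lemma esym_0: "finite V \<Longrightarrow> esym 0 V x = 1"
proof -
  assume "finite V"
  hence "{f. f \<subseteq> V \<and> card f = 0} = {{}}" using finite_subset by fastforce
  thus ?thesis unfolding esym_def by simp
qed

lemma esym_1: "finite V \<Longrightarrow> esym 1 V x = (\<Sum>i\<in>V. x i)"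
  unfolding One_nat_def
  by (induction V rule: finite_induct) (auto simp: esym_Suc_insert esym_0)

lemma esym_2: "finite V \<Longrightarrow> 2 * esym 2 V x = (\<Sum>i\<in>V. x i)\<^sup>2 - (\<Sum>i\<in>V. (x i)\<^sup>2)"
proof (induction V rule: finite_induct)
  case empty
  show ?case by (simp add: numeral_2_eq_2)
next
  case (insert i V)
  have "esym 2 (insert i V) x = esym 2 V x + x i * (\<Sum>i\<in>V. x i)"
    using esym_Suc_insert[OF insert.hyps, of 1 x] esym_1[OF insert.hyps(1)]
    by (simp add: numeral_2_eq_2)
  thus ?case using insert by (simp add: algebra_simps power2_eq_square)
qed

text \<open>Newton's identity, by adding one vertex at a time. It turns the weight of a clique into
  power sums, in which the later estimates are made.\<close>

lemma esym_3: "finite V \<Longrightarrow> 6 * esym 3 V x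
   = (\<Sum>i\<in>V. x i)^3 - 3 * (\<Sum>i\<in>V. x i) * (\<Sum>i\<in>V. (x i)\<^sup>2) + 2 * (\<Sum>i\<in>V. (x i)^3)"
proof (induction V rule: finite_induct)
  case empty
  show ?case by (simp add: numeral_3_eq_3)
next
  case (insert i V)
  have "6 * esym 3 (insert i V) x = 6 * esym 3 V x + 3 * x i * (2 * esym 2 V x)"
    using esym_Suc_insert[OF insert.hyps, of 2 x] by (simp add: numeral_3_eq_3)
  thus ?case using insert esym_2[OF insert.hyps(1), of x]
    by (simp add: algebra_simps power2_eq_square power3_eq_cube)
qed

lemma esym_cong: "(\<And>i. i \<in> V \<Longrightarrow> x i = y i) \<Longrightarrow> esym k V x = esym k V y"
  unfolding esym_def by (intro sum.cong prod.cong) auto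

lemma sum_prod_le_esym:
  assumes "finite V" "E \<subseteq> {f. f \<subseteq> V \<and> card f = k}" "\<And>i. i \<in> V \<Longrightarrow> 0 \<le> x i"
  shows "(\<Sum>f\<in>E. \<Prod>i\<in>f. x i) \<le> esym k V x"
  unfolding esym_def using assms by (intro sum_mono2 prod_nonneg) auto

text \<open>Euler's identity for a homogeneous cubic: each triple is counted once for each of its
  three vertices. At constant weights 1 it becomes the degree sum.\<close>

lemma sum_link_weight:
  assumes "finite V" "E \<subseteq> {f. f \<subseteq> V \<and> card f = 3}"
  shows "(\<Sum>i\<in>V. x i * link_weight E x i) = 3 * (\<Sum>f\<in>E. \<Prod>i\<in>f. x i)"
proof -
  have fE: "finite E" using assms by (auto intro: finite_subset)
  have "(\<Sum>i\<in>V. x i * link_weight E x i) = (\<Sum>i\<in>V. \<Sum>f | f \<in> E \<and> i \<in> f. \<Prod>j\<in>f. x j)"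
    unfolding link_weight_def sum_distrib_left
  proof (intro sum.cong refl)
    fix i f assume "f \<in> {f. f \<in> E \<and> i \<in> f}"
    hence "finite f" "i \<in> f" using assms by (auto intro: finite_subset)
    thus "x i * (\<Prod>j\<in>f - {i}. x j) = (\<Prod>j\<in>f. x j)" by (simp add: prod.remove)
  qed
  also have "\<dots> = (\<Sum>f\<in>E. \<Sum>i | i \<in> V \<and> i \<in> f. \<Prod>j\<in>f. x j)"
    by (rule sum.swap_restrict[OF assms(1) fE])
  also have "\<dots> = (\<Sum>f\<in>E. 3 * (\<Prod>j\<in>f. x j))"
  proof (intro sum.cong refl)
    fix f assume "f \<in> E"
    hence "{i. i \<in> V \<and> i \<in> f} = f" "card f = 3" using assms by auto
    thus "(\<Sum>i | i \<in> V \<and> i \<in> f. \<Prod>j\<in>f. x j) = 3 * (\<Prod>j\<in>f. x j)" by simp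
  qed
  finally show ?thesis by (simp add: sum_distrib_left)
qed

section \<open>Lower bounds on the Lagrangian of colex graphs\<close>

lemma lagrangian_mono:
  assumes G: "three_graph G" and H: "three_graph H"
    and V: "verts G \<subseteq> verts H" and E: "edges G \<subseteq> edges H" and ne: "verts G \<noteq> {}"
  shows "lagrangian G \<le> lagrangian H"
proof -
  have fin: "finite (verts H)" using H by (simp add: three_graph_def)
  obtain x where x: "legal_weighting G x" "weight G x = lagrangian G"
    using lagrangian_attained(1)[OF G ne] by auto
  define y where "y i = (if i \<in> verts G then x i else 0)" for i
  have y0: "y i \<ge> 0" for i using x(1) by (simp add: y_def legal_weighting_def)
  have "(\<Sum>i\<in>verts H. y i) = (\<Sum>i\<in>verts G. x i)"
    unfolding y_def using fin V by (simp add: sum.inter_restrict[symmetric] Int_absorb1)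
  hence ly: "legal_weighting H y" using x(1) y0 by (simp add: legal_weighting_def)
  have "weight G x = (\<Sum>e\<in>edges G. \<Prod>i\<in>e. y i)"
    unfolding weight_def y_def using G by (intro sum.cong prod.cong) (auto simp: three_graph_def)
  also have "\<dots> \<le> weight H y"
    unfolding weight_def using three_graph_finite_edges[OF H] E y0
    by (intro sum_mono2 prod_nonneg) auto
  also have "\<dots> \<le> lagrangian H"
    using lagrangian_attained(2)[OF H _ ly] V ne by blast
  finally show ?thesis using x(2) by simp
qed

text \<open>The predecessors of a member \<open>A\<close> lie in \<open>S - {A}\<close>, so there
  are fewer than \<open>k\<close> of them; no rank has to be computed.\<close>

lemma colex_downset_subset:
  assumes S: "S \<subseteq> triples" "finite S" "card S \<le> k"
    and down: "\<And>A B. A \<in> S \<Longrightarrow> B \<in> triples \<Longrightarrow> colex_less B A \<Longrightarrow> B \<in> S"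
  shows "S \<subseteq> colex_edges k"
proof
  fix A assume A: "A \<in> S"
  have "{B \<in> triples. colex_less B A} \<subseteq> S - {A}"
    using down[OF A] by (auto simp: colex_less_def)
  hence "card {B \<in> triples. colex_less B A} \<le> card (S - {A})" using S by (intro card_mono) auto
  also have "\<dots> < card S" using S A by (intro psubset_card_mono) auto
  finally show "A \<in> colex_edges k" using A S by (auto simp: colex_edges_def)
qed

lemma colex_less_iff:
  assumes "finite A" "finite B"
  shows "colex_less A B \<longleftrightarrow> (\<exists>j. j \<in> B \<and> j \<notin> A \<and> (\<forall>i>j. i \<in> A \<longleftrightarrow> i \<in> B))"
proof
  assume c: "colex_less A B"
  let ?D = "sym_diff A B"
  have D: "finite ?D" "?D \<noteq> {}" using assms c by (auto simp: colex_less_def)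
  have "Max ?D \<in> ?D" by (rule Max_in[OF D])
  moreover have "i \<in> A \<longleftrightarrow> i \<in> B" if "i > Max ?D" for i
    using Max_ge[OF D(1), of i] that by auto
  ultimately show "\<exists>j. j \<in> B \<and> j \<notin> A \<and> (\<forall>i>j. i \<in> A \<longleftrightarrow> i \<in> B)"
    using c by (auto simp: colex_less_def)
next
  assume "\<exists>j. j \<in> B \<and> j \<notin> A \<and> (\<forall>i>j. i \<in> A \<longleftrightarrow> i \<in> B)"
  then obtain j where j: "j \<in> B" "j \<notin> A" "\<And>i. i > j \<Longrightarrow> i \<in> A \<longleftrightarrow> i \<in> B" by auto
  have "Max (sym_diff A B) = j"
    using assms j by (intro Max_eqI) (auto simp: not_less[symmetric])
  thus "colex_less A B" using j by (auto simp: colex_less_def)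
qed

text \<open>For \<open>r + 2 \<le> n\<close>, the last \<open>r\<close> triples of \<open>{1..n}\<close> in colex order are those removed here.\<close>

definition colex_initial :: "nat \<Rightarrow> nat \<Rightarrow> nat set set" where
  "colex_initial n r = {A. A \<subseteq> {1..n} \<and> card A = 3} - (\<lambda>i. {i, n - 1, n}) ` {n - 1 - r..n - 2}"

lemma card_colex_initial:
  assumes "r + 3 \<le> n"
  shows "card (colex_initial n r) = (n choose 3) - r"
proof -
  have "inj_on (\<lambda>i. {i, n - 1, n}) {n - 1 - r..n - 2}"
    by (rule inj_onI) (use assms in \<open>auto simp: doubleton_eq_iff insert_eq_iff\<close>)
  hence "card ((\<lambda>i. {i, n - 1, n}) ` {n - 1 - r..n - 2}) = r"
    using assms by (simp add: card_image)
  moreover have "(\<lambda>i. {i, n - 1, n}) ` {n - 1 - r..n - 2} \<subseteq> {A. A \<subseteq> {1..n} \<and> card A = 3}"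
    using assms by (auto simp: card_insert_if)
  ultimately show ?thesis unfolding colex_initial_def
    by (subst card_Diff_subset) (auto simp: n_subsets)
qed

lemma colex_initial_subset:
  assumes "r + 3 \<le> n" "(n choose 3) - r \<le> k"
  shows "colex_initial n r \<subseteq> colex_edges k"
proof (rule colex_downset_subset)
  show "colex_initial n r \<subseteq> triples" by (auto simp: colex_initial_def triples_def)
  show "finite (colex_initial n r)" by (simp add: colex_initial_def)
  show "card (colex_initial n r) \<le> k" using assms card_colex_initial by simp
next
  fix A B assume A: "A \<in> colex_initial n r" and B: "B \<in> triples" and less: "colex_less B A"
  have A3: "A \<subseteq> {1..n}" "card A = 3" and B3: "B \<subseteq> {1..}" "card B = 3"
    using A B by (auto simp: colex_initial_def triples_def)
  have fin: "finite A" "finite B" using A3 B by (auto simp: finite_triple intro: finite_subset)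
  obtain j where j: "j \<in> A" "j \<notin> B" "\<And>i. i > j \<Longrightarrow> i \<in> B \<longleftrightarrow> i \<in> A"
    using less fin by (auto simp: colex_less_iff)
  have "i \<le> n" if "i \<in> B" for i
    using that j A3(1) by (cases "i > j") (auto simp: subset_iff not_less intro: order_trans)
  hence Bn: "B \<subseteq> {1..n}" using B3 by auto
  have "B \<noteq> {i, n - 1, n}" if i: "i \<in> {n - 1 - r..n - 2}" for i
  proof
    assume Bi: "B = {i, n - 1, n}"
    have "j \<le> n" "j \<ge> 1" using j(1) A3(1) by auto
    \<comment> \<open>\<open>j\<close> is outside \<open>B\<close>, hence neither \<open>n\<close>
      nor \<open>n - 1\<close>. So \<open>A\<close> also contains these two, and with
      \<open>i \<le> j\<close> it would itself be a removed triple.\<close>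
    hence jn: "j < n - 1" using j(2) Bi by auto
    hence "n \<in> A" "n - 1 \<in> A" using j(3)[of n] j(3)[of "n - 1"] Bi by auto
    moreover have "card {j, n - 1, n} = 3" using jn by (auto simp: card_insert_if)
    ultimately have "A = {j, n - 1, n}"
      using j(1) A3 fin by (intro card_subset_eq[symmetric]) auto
    moreover have "i \<le> j"
    proof (rule ccontr)
      assume "\<not> i \<le> j"
      hence "i \<in> A" using j(3)[of i] Bi by auto
      with \<open>A = {j, n - 1, n}\<close> \<open>\<not> i \<le> j\<close> have "i = n - 1 \<or> i = n" by auto
      with i assms(1) show False by auto
    qed
    ultimately show False using A i jn by (auto simp: colex_initial_def)
  qed
  thus "B \<in> colex_initial n r" unfolding colex_initial_def using Bn B3 by blast
qed

text \<open>The complete graph on \<open>V\<close> without the triples \<open>{i, a, b}\<close>,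
  \<open>i \<in> R\<close>, has this weight at \<open>x\<close>. It embeds into
  \<open>colex_initial\<close>, where again only triples through two fixed vertices are
  absent.\<close>

lemma weight_le_lagrangian_colex:
  assumes V: "finite V" "a \<in> V" "b \<in> V" "a \<noteq> b" and R: "R \<subseteq> V - {a, b}"
    and r: "card R + 3 \<le> card V" and k: "(card V choose 3) - card R \<le> k"
    and x: "\<And>i. i \<in> V \<Longrightarrow> 0 \<le> x i" "(\<Sum>i\<in>V. x i) = 1"
  shows "esym 3 V x - x a * x b * (\<Sum>i\<in>R. x i) \<le> lagrangian (colex_graph k)"
proof -
  let ?n = "card V" and ?r = "card R"
  define W where "W = V - {a, b} - R"
  have fin: "finite R" "finite W" using V R by (auto simp: W_def intro: finite_subset)
  have VW: "V = {a, b} \<union> R \<union> W" using V R by (auto simp: W_def)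
  have cV: "?n = 2 + ?r + card W"
  proof -
    have "card (V - {a, b}) = ?n - 2" using V by (subst card_Diff_subset) auto
    moreover have "card W = card (V - {a, b}) - ?r"
      unfolding W_def using R fin(1) by (intro card_Diff_subset)
    ultimately show ?thesis using r by simp
  qed
  obtain h1 where h1: "bij_betw h1 W {1..?n - 2 - ?r}"
    using finite_same_card_bij[of W "{1..?n - 2 - ?r}", OF fin(2) finite_atLeastAtMost] cV by fastforce
  obtain h2 where h2: "bij_betw h2 R {?n - 1 - ?r..?n - 2}"
    using finite_same_card_bij[of R "{?n - 1 - ?r..?n - 2}", OF fin(1) finite_atLeastAtMost] r by fastforce
  \<comment> \<open>\<open>a\<close> and \<open>b\<close> become the last two vertices and
    \<open>R\<close> the block just below them, to match the triples removed in
    \<open>colex_initial\<close>.\<close>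
  define h where "h v = (if v = a then ?n else if v = b then ?n - 1 else if v \<in> R then h2 v else h1 v)" for v
  have h_R: "h v = h2 v" if "v \<in> R" for v using that R by (auto simp: h_def)
  have h_W: "h v = h1 v" if "v \<in> W" for v using that by (auto simp: h_def W_def)
  have im: "h ` R = {?n - 1 - ?r..?n - 2}" "h ` W = {1..?n - 2 - ?r}"
    using h1 h2 h_R h_W by (auto simp: bij_betw_def)
  hence hR: "h v \<in> {?n - 1 - ?r..?n - 2}" if "v \<in> R" for v using that by blast
  have hW: "h v \<in> {1..?n - 2 - ?r}" if "v \<in> W" for v using that im by blast
  have hab: "h a = ?n" "h b = ?n - 1" using V(4) by (simp_all add: h_def)
  have inj: "inj_on h V"
  proof -
    have "inj_on h W" using h1 h_W inj_on_cong[of W h h1] by (simp add: bij_betw_def)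
    moreover have "inj_on h R" using h2 h_R inj_on_cong[of R h h2] by (simp add: bij_betw_def)
    moreover have "h ` R \<inter> h ` W = {}" unfolding im by auto
    ultimately have "inj_on h (R \<union> W)" unfolding inj_on_Un by blast
    moreover have "h b \<notin> h ` (R \<union> W)" unfolding hab image_Un im using r by auto
    moreover have "h a \<notin> h ` (R \<union> W)" "h a \<noteq> h b" unfolding hab image_Un im using r by auto
    moreover have "V = insert a (insert b (R \<union> W))" using VW by auto
    ultimately show ?thesis by auto
  qed
  have hV: "h ` V \<subseteq> {1..?n}"
  proof -
    have "h ` V = {?n, ?n - 1} \<union> {?n - 1 - ?r..?n - 2} \<union> {1..?n - 2 - ?r}"
      using arg_cong[OF VW, of "(`) h"] by (simp only: image_Un im image_insert image_empty hab)
    thus ?thesis using r by auto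
  qed
  define F where "F = {f. f \<subseteq> V \<and> card f = 3} - (\<lambda>i. {i, a, b}) ` R"
  have abR: "(\<lambda>i. {i, a, b}) ` R \<subseteq> {f. f \<subseteq> V \<and> card f = 3}" using V R by (auto simp: card_insert_if)
  have hF: "h ` f \<in> colex_initial ?n ?r" if f: "f \<in> F" for f
  proof -
    have fV: "f \<subseteq> V" "card f = 3" using f by (auto simp: F_def)
    have "card (h ` f) = 3" using fV inj by (metis card_image inj_on_subset)
    moreover have "h ` f \<subseteq> {1..?n}" using fV hV by blast
    moreover have "h ` f \<noteq> {i, ?n - 1, ?n}" if i: "i \<in> {?n - 1 - ?r..?n - 2}" for i
    proof
      assume eq: "h ` f = {i, ?n - 1, ?n}"
      obtain v where v: "v \<in> R" "i = h v" using i im by blast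
      have "h ` f = h ` {v, a, b}" using eq v hab by auto
      hence "f = {v, a, b}" using inj_on_image_eq_iff[OF inj fV(1), of "{v, a, b}"] v R V by auto
      thus False using f v by (auto simp: F_def)
    qed
    ultimately show ?thesis unfolding colex_initial_def by blast
  qed
  let ?H = "(\<Union>((`) h ` F), (`) h ` F)"
  have F3: "f \<subseteq> V" "card f = 3" if "f \<in> F" for f using that by (auto simp: F_def)
  have VF: "three_graph (V, F)" using V F3 by (auto simp: three_graph_def)
  have H3: "card (h ` f) = 3" if "f \<in> F" for f using F3[OF that] inj by (metis card_image inj_on_subset)
  have fF: "finite F" using three_graph_finite_edges[OF VF] by simp
  have tH: "three_graph ?H"
    using H3 fF finite_subset[OF F3(1) V(1)] by (auto simp: three_graph_def)
  have Fne: "F \<noteq> {}"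
  proof -
    have "card W \<noteq> 0" using cV r by linarith
    then obtain w where w: "w \<in> W" by (metis card.empty ex_in_conv)
    hence "{w, a, b} \<in> {f. f \<subseteq> V \<and> card f = 3}" "\<forall>i\<in>R. {w, a, b} \<noteq> {i, a, b}"
      using V R by (auto simp: W_def card_insert_if)
    hence "{w, a, b} \<in> F" unfolding F_def by blast
    thus ?thesis by auto
  qed
  have "(\<Sum>f\<in>(\<lambda>i. {i, a, b}) ` R. \<Prod>i\<in>f. x i) = (\<Sum>i\<in>R. x a * x b * x i)"
  proof (subst sum.reindex)
    show "inj_on (\<lambda>i. {i, a, b}) R" using R by (intro inj_onI) blast
    show "sum ((\<lambda>f. \<Prod>i\<in>f. x i) \<circ> (\<lambda>i. {i, a, b})) R = (\<Sum>i\<in>R. x a * x b * x i)"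
    proof (intro sum.cong refl)
      fix i assume "i \<in> R"
      hence "i \<noteq> a" "i \<noteq> b" using R by auto
      thus "((\<lambda>f. \<Prod>i\<in>f. x i) \<circ> (\<lambda>i. {i, a, b})) i = x a * x b * x i" using V(4) by simp
    qed
  qed
  hence "weight (V, F) x = esym 3 V x - x a * x b * (\<Sum>i\<in>R. x i)"
    unfolding weight_def esym_def F_def using sum_diff[OF _ abR, of "\<lambda>f. \<Prod>i\<in>f. x i"] V(1)
    by (simp add: sum_distrib_left)
  moreover have "weight (V, F) x \<le> lagrangian (V, F)"
    using lagrangian_attained(2)[OF VF] V x by (auto simp: legal_weighting_def)
  moreover have "lagrangian (V, F) \<le> lagrangian ?H"
    using Fne F3 by (intro lagrangian_le_embed[OF VF tH, of h] inj_on_subset[OF inj]) auto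
  moreover have "lagrangian ?H \<le> lagrangian (colex_graph k)"
  proof (rule lagrangian_mono[OF tH three_graph_colex_graph])
    have "(`) h ` F \<subseteq> colex_edges k" using hF colex_initial_subset[OF r k] by blast
    thus "edges ?H \<subseteq> edges (colex_graph k)" "verts ?H \<subseteq> verts (colex_graph k)"
      by (auto simp: colex_graph_def)
    obtain f where "f \<in> F" using Fne by auto
    moreover have "f \<noteq> {}" using F3[OF \<open>f \<in> F\<close>] by auto
    ultimately show "verts ?H \<noteq> {}" by auto
  qed
  ultimately show ?thesis by simp
qed

lemma esym_3_le_lagrangian_colex:
  assumes V: "finite V" "(card V choose 3) \<le> k" "3 \<le> card V"
    and x: "\<And>i. i \<in> V \<Longrightarrow> 0 \<le> x i" "(\<Sum>i\<in>V. x i) = 1"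
  shows "esym 3 V x \<le> lagrangian (colex_graph k)"
proof -
  obtain a where a: "a \<in> V" using V by fastforce
  have "card (V - {a}) \<noteq> 0" using V a by simp
  then obtain b where "b \<in> V - {a}" by (metis card.empty ex_in_conv)
  with a show ?thesis using weight_le_lagrangian_colex[of V a b "{}" k x] V x by auto
qed

lemma uniform_le_lagrangian_colex:
  assumes "3 \<le> n" "(n choose 3) \<le> k"
  shows "1 - 3 / n + 2 / n\<^sup>2 \<le> 6 * lagrangian (colex_graph k)"
proof -
  have "6 * esym 3 {1..n} (\<lambda>_. 1 / real n) = 1 - 3 / n + 2 / n\<^sup>2"
    using assms by (simp add: esym_3 power2_eq_square power3_eq_cube)
  moreover have "esym 3 {1..n} (\<lambda>_. 1 / real n) \<le> lagrangian (colex_graph k)"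
    using assms by (intro esym_3_le_lagrangian_colex) auto
  ultimately show ?thesis by simp
qed

section \<open>The structure of optimal weightings\<close>

text \<open>Homogeneity replaces Lagrange multipliers: \<open>w (x + \<epsilon> e\<^sub>i) = w x + \<epsilon> \<partial>\<^sub>i w x\<close> is at most
  \<open>(1 + \<epsilon>)\<^sup>3 w x\<close>, so \<open>\<partial>\<^sub>i w x \<le> 3 w x\<close>, and the weighted average of the \<open>\<partial>\<^sub>i w x\<close> is \<open>3 w x\<close>.\<close>

lemma link_weight_optimal:
  assumes V: "finite V" and E: "E \<subseteq> {f. f \<subseteq> V \<and> card f = 3}"
    and x: "\<And>i. i \<in> V \<Longrightarrow> 0 < x i" "(\<Sum>i\<in>V. x i) = 1"
    and opt: "\<And>y. (\<And>i. i \<in> V \<Longrightarrow> 0 \<le> y i) \<Longrightarrow> (\<Sum>i\<in>V. y i) = 1 \<Longrightarrow>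
      (\<Sum>f\<in>E. \<Prod>j\<in>f. y j) \<le> (\<Sum>f\<in>E. \<Prod>j\<in>f. x j)"
    and i: "i \<in> V"
  shows "link_weight E x i = 3 * (\<Sum>f\<in>E. \<Prod>j\<in>f. x j)"
proof -
  define l where "l = (\<Sum>f\<in>E. \<Prod>j\<in>f. x j)"
  have fE: "finite E" "\<And>f. f \<in> E \<Longrightarrow> finite f"
    using E V by (auto intro: finite_subset)
  have l0: "l \<ge> 0" unfolding l_def
  proof (intro sum_nonneg prod_nonneg)
    fix f j assume "f \<in> E" "j \<in> f"
    hence "j \<in> V" using E by auto
    thus "0 \<le> x j" using x(1)[of j] by simp
  qed
  have le: "link_weight E x i \<le> 3 * l" if i: "i \<in> V" for i
  proof (rule field_le_epsilon)
    fix d :: real assume d: "d > 0"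
    \<comment> \<open>\<open>e \<le> 1\<close> bounds \<open>3 * e + e * e\<close> by
      \<open>4 * e\<close>; the other entry keeps the error \<open>4 * e * l\<close> below
      \<open>d\<close>, with \<open>+ 1\<close> to cover \<open>l = 0\<close>.\<close>
    define e where "e = min 1 (d / (4 * l + 1))"
    have e: "e > 0" "e \<le> 1" "e * (4 * l) \<le> d"
    proof -
      show "e > 0" "e \<le> 1" using d l0 by (auto simp: e_def)
      have "e * (4 * l) \<le> d / (4 * l + 1) * (4 * l + 1)"
        using d l0 by (intro mult_mono) (auto simp: e_def)
      thus "e * (4 * l) \<le> d" using l0 by simp
    qed
    define y where "y j = x j + (if j = i then e else 0)" for j
    define z where "z j = y j / (1 + e)" for j
    have y0: "y j \<ge> 0" if "j \<in> V" for j using that x(1)[of j] e by (simp add: y_def)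
    have "(\<Sum>j\<in>V. y j) = 1 + e" unfolding y_def sum.distrib using V i x by simp
    hence "(\<Sum>j\<in>V. z j) = 1" unfolding z_def using e by (simp flip: sum_divide_distrib)
    hence "(\<Sum>f\<in>E. \<Prod>j\<in>f. z j) \<le> l" unfolding l_def using y0 e by (intro opt) (auto simp: z_def)
    moreover have "(\<Sum>f\<in>E. \<Prod>j\<in>f. z j) = (\<Sum>f\<in>E. \<Prod>j\<in>f. y j) / (1 + e)^3"
      unfolding sum_divide_distrib z_def prod_dividef using E by (intro sum.cong) auto
    ultimately have "(\<Sum>f\<in>E. \<Prod>j\<in>f. y j) \<le> l * (1 + e)^3"
      using e by (simp add: pos_divide_le_eq)
    moreover have "(\<Sum>f\<in>E. \<Prod>j\<in>f. y j) = l + e * link_weight E x i"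
    proof -
      have "link_weight E y i = link_weight E x i"
        unfolding link_weight_def by (intro sum.cong prod.cong) (auto simp: y_def)
      moreover have "(\<Sum>f | f \<in> E \<and> i \<notin> f. \<Prod>j\<in>f. y j) = (\<Sum>f | f \<in> E \<and> i \<notin> f. \<Prod>j\<in>f. x j)"
        by (intro sum.cong prod.cong) (auto simp: y_def)
      ultimately show ?thesis
        using sum_split_link[OF fE, of y i] sum_split_link[OF fE, of x i]
        by (simp add: l_def y_def algebra_simps)
    qed
    ultimately have "e * link_weight E x i \<le> e * (l * (3 + 3 * e + e * e))"
      by (simp add: power3_eq_cube algebra_simps)
    hence "link_weight E x i \<le> l * (3 + 3 * e + e * e)" using e by simp
    also have "\<dots> \<le> l * (3 + 4 * e)" using e l0 by (intro mult_left_mono) (auto simp: mult_left_le)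
    also have "\<dots> \<le> 3 * l + d" using e by (simp add: algebra_simps)
    finally show "link_weight E x i \<le> 3 * l + d" .
  qed
  have "(\<Sum>j\<in>V. x j * (3 * l - link_weight E x j)) = 0"
    using sum_link_weight[OF V E, of x] x(2)
    by (simp add: l_def algebra_simps sum_subtractf flip: sum_distrib_left sum_distrib_right)
  moreover have "\<forall>j\<in>V. 0 \<le> x j * (3 * l - link_weight E x j)"
    using le x(1) by (intro ballI mult_nonneg_nonneg) (auto simp: less_imp_le)
  ultimately have "x i * (3 * l - link_weight E x i) = 0"
    using sum_nonneg_eq_0_iff[OF V, of "\<lambda>j. x j * (3 * l - link_weight E x j)"] i by blast
  thus ?thesis using x(1)[OF i] unfolding l_def by simp
qed

section \<open>Auxiliary counting and size estimates\<close>

lemma link_weight_mono: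
  assumes "finite F" "E \<subseteq> F" "\<And>f j. f \<in> F \<Longrightarrow> j \<in> f \<Longrightarrow> 0 \<le> x j"
  shows "link_weight E x i \<le> link_weight F x i"
  unfolding link_weight_def using assms by (intro sum_mono2 prod_nonneg) auto

lemma card_triples_containing_pair:
  assumes "finite V" "i \<noteq> j"
  shows "card {f. f \<subseteq> V \<and> card f = 3 \<and> i \<in> f \<and> j \<in> f} \<le> card V"
proof -
  have "{f. f \<subseteq> V \<and> card f = 3 \<and> i \<in> f \<and> j \<in> f} \<subseteq> (\<lambda>k. {i, j, k}) ` V"
  proof
    fix f assume f: "f \<in> {f. f \<subseteq> V \<and> card f = 3 \<and> i \<in> f \<and> j \<in> f}"
    hence "card (f - {i, j}) = 1" using assms(2) by (subst card_Diff_subset) auto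
    then obtain k where "f - {i, j} = {k}" by (auto simp: card_1_singleton_iff)
    hence "f = {i, j, k}" "k \<in> V" using f by auto
    thus "f \<in> (\<lambda>k. {i, j, k}) ` V" by blast
  qed
  hence "card {f. f \<subseteq> V \<and> card f = 3 \<and> i \<in> f \<and> j \<in> f} \<le> card ((\<lambda>k. {i, j, k}) ` V)"
    using assms(1) by (intro card_mono) auto
  also have "\<dots> \<le> card V" using assms(1) by (rule card_image_le)
  finally show ?thesis .
qed

text \<open>In Newton's identity the sum of cubes is at most the product of the first two power
  sums, so the correction terms are not positive. The factor 6 is given away.\<close>

lemma esym_3_le_cube:
  assumes "finite V" "\<And>i. i \<in> V \<Longrightarrow> 0 \<le> x i"
  shows "esym 3 V x \<le> (\<Sum>i\<in>V. x i)^3"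
proof -
  have "(\<Sum>i\<in>V. (x i)^3) \<le> (\<Sum>i\<in>V. (\<Sum>j\<in>V. x j) * (x i)\<^sup>2)"
  proof (rule sum_mono)
    fix i assume i: "i \<in> V"
    have "x i \<le> (\<Sum>j\<in>V. x j)" using assms i by (intro member_le_sum) auto
    hence "x i * (x i)\<^sup>2 \<le> (\<Sum>j\<in>V. x j) * (x i)\<^sup>2" by (intro mult_right_mono) auto
    thus "(x i)^3 \<le> (\<Sum>j\<in>V. x j) * (x i)\<^sup>2" by (simp add: power3_eq_cube power2_eq_square)
  qed
  hence *: "(\<Sum>i\<in>V. (x i)^3) \<le> (\<Sum>i\<in>V. x i) * (\<Sum>i\<in>V. (x i)\<^sup>2)"
    by (simp add: sum_distrib_left)
  have "0 \<le> (\<Sum>i\<in>V. (x i)^3)" "0 \<le> (\<Sum>i\<in>V. x i)^3"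
    using assms(2) by (auto intro!: sum_nonneg)
  with * show ?thesis using esym_3[OF assms(1), of x] by linarith
qed

lemma six_choose_3: "6 * real ((n + 1) choose 3) = real n ^ 3 - real n"
proof (induction n)
  case (Suc n)
  have "6 * real ((Suc n + 1) choose 3) = 6 * real ((n + 1) choose 3) + 3 * (2 * real ((n + 1) choose 2))"
    by (simp add: numeral_3_eq_3 numeral_2_eq_2)
  also have "2 * real ((n + 1) choose 2) = real (n + 1) * n"
    by (simp add: choose_two real_of_nat_div algebra_simps)
  finally show ?case using Suc by (simp add: algebra_simps power3_eq_cube)
qed (simp add: numeral_3_eq_3)

text \<open>An optimum restricted to its support, with the Lagrange condition as
  \<open>link\<close>. \<open>w_large\<close> is slightly weaker than beating the uniform clique on
  \<open>T\<close> vertices: the term \<open>2 / T\<^sup>2\<close> is dropped.\<close>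

locale near_clique_optimum =
  fixes V :: "'a set" and E :: "'a set set" and x :: "'a \<Rightarrow> real" and w :: real and T :: nat
  assumes finV: "finite V" and E_sub: "E \<subseteq> {f. f \<subseteq> V \<and> card f = 3}"
    and pos: "\<And>i. i \<in> V \<Longrightarrow> 0 < x i" and sum_x: "(\<Sum>i\<in>V. x i) = 1"
    and w_def: "w = (\<Sum>f\<in>E. \<Prod>i\<in>f. x i)"
    and link: "\<And>i. i \<in> V \<Longrightarrow> link_weight E x i = 3 * w"
    and card_E: "card E \<le> (T + 1) choose 3"
    and w_large: "1 - 3 / T \<le> 6 * w" and T_large: "10000 \<le> T"
begin

definition p2 :: real where "p2 = (\<Sum>i\<in>V. (x i)\<^sup>2)"
definition p3 :: real where "p3 = (\<Sum>i\<in>V. (x i)^3)"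
definition M :: "'a set set" where "M = {f. f \<subseteq> V \<and> card f = 3} - E"
definition Mx :: real where "Mx = (\<Sum>f\<in>M. \<Prod>i\<in>f. x i)"
text \<open>The threshold is half the typical weight \<open>1 / T\<close>. Products over the other
  vertices are bounded below, and the light vertices turn out to be boundedly many.\<close>

definition light :: "'a set" where "light = {i \<in> V. x i < 1 / (2 * T)}"

section \<open>Power sums, links and degrees at an optimum\<close>

lemma nonneg: "i \<in> V \<Longrightarrow> 0 \<le> x i"
  using pos by (simp add: less_imp_le)

lemma finE: "finite E" and finM: "finite M"
  using finV E_sub by (auto simp: M_def intro: finite_subset)

lemma M_sub: "M \<subseteq> {f. f \<subseteq> V \<and> card f = 3}" by (auto simp: M_def)

lemma Mx_eq: "Mx = esym 3 V x - w"
  unfolding Mx_def M_def w_def esym_def using finV E_sub by (intro sum_diff) auto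

lemma six_esym_3: "6 * esym 3 V x = 1 - 3 * p2 + 2 * p3"
  using esym_3[OF finV, of x] by (simp add: sum_x p2_def p3_def)

lemma Mx_nonneg: "0 \<le> Mx"
  unfolding Mx_def using M_sub nonneg by (intro sum_nonneg prod_nonneg) auto

lemma w_le_esym: "w \<le> esym 3 V x" using Mx_eq Mx_nonneg by simp

lemma two_esym_2: "i \<in> V \<Longrightarrow> 2 * esym 2 (V - {i}) x = 1 - 2 * x i + 2 * (x i)\<^sup>2 - p2"
  using esym_2[of "V - {i}" x] finV
  by (simp add: sum_diff1 sum_x p2_def power2_eq_square algebra_simps)

text \<open>The Lagrange condition makes the link of \<open>E\<close> constant, so the missing link
  is the complete one minus \<open>3 * w\<close>. Its nonnegativity bounds weights from above; upper
  bounds on it limit the missing triples at \<open>i\<close>.\<close>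

lemma link_M:
  assumes "i \<in> V"
  shows "link_weight M x i = esym 2 (V - {i}) x - 3 * w"
proof -
  let ?A = "{f. f \<subseteq> V \<and> card f = Suc 2}"
  have "{f. f \<in> M \<and> i \<in> f} = {f. f \<in> ?A \<and> i \<in> f} - {f. f \<in> E \<and> i \<in> f}"
    by (auto simp: M_def)
  hence "link_weight M x i = link_weight ?A x i - link_weight E x i"
    unfolding link_weight_def using finV E_sub by (simp only:) (intro sum_diff, auto)
  thus ?thesis using link_weight_ksubsets[OF finV assms, of 2 x] link[OF assms] by simp
qed

lemma link_M_nonneg: "0 \<le> link_weight M x i"
  unfolding link_weight_def using M_sub nonneg by (intro sum_nonneg prod_nonneg) auto

lemma T_pos: "0 < real T" using T_large by simp

lemma p2_nonneg: "0 \<le> p2" unfolding p2_def by (intro sum_nonneg) auto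

lemma sq_le_p2: "i \<in> V \<Longrightarrow> (x i)\<^sup>2 \<le> p2"
  unfolding p2_def using finV by (intro member_le_sum) auto

lemma x_le_1: "i \<in> V \<Longrightarrow> x i \<le> 1"
  using member_le_sum[of i V x] finV nonneg by (simp add: sum_x)

lemma p3_le_bound:
  assumes "\<And>i. i \<in> V \<Longrightarrow> x i \<le> c"
  shows "p3 \<le> c * p2"
  unfolding p3_def p2_def sum_distrib_left
proof (rule sum_mono)
  fix i assume "i \<in> V"
  hence "x i * (x i)\<^sup>2 \<le> c * (x i)\<^sup>2" using assms by (intro mult_right_mono) auto
  thus "(x i)^3 \<le> c * (x i)\<^sup>2" by (simp add: power3_eq_cube power2_eq_square)
qed

lemma power_sums_le: "3 * p2 - 2 * p3 \<le> 3 / T"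
  using six_esym_3 w_le_esym w_large by linarith

text \<open>Bootstrap: the trivial \<open>p3 \<le> p2\<close> gives \<open>p2 \<le> 3 / T\<close>
  and so \<open>x i \<le> 1 / 2\<close>. Then \<open>2 * (x i)\<^sup>2 \<le> x i\<close>, and
  \<open>link_M_nonneg\<close> becomes a linear bound on \<open>x i\<close>.\<close>

lemma x_le:
  assumes i: "i \<in> V"
  shows "x i \<le> 3 / T"
proof -
  have "p2 \<le> 3 / T" using p3_le_bound[of 1] x_le_1 power_sums_le by simp
  also have "\<dots> \<le> (1 / 2)\<^sup>2" using T_large by (simp add: field_simps power2_eq_square)
  finally have "x i \<le> 1 / 2" using sq_le_p2[OF i] power2_le_imp_le[of "x i" "1 / 2"] by simp
  hence "x i * x i \<le> x i * (1 / 2)" using nonneg[OF i] by (intro mult_left_mono) auto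
  moreover have "1 - 3 / T \<le> 1 - 2 * x i + 2 * (x i)\<^sup>2 - p2"
    using link_M[OF i] link_M_nonneg[of i] w_large two_esym_2[OF i] by linarith
  ultimately show ?thesis using p2_nonneg by (simp add: power2_eq_square)
qed

lemma p3_le: "p3 \<le> 3 / T * p2"
  by (rule p3_le_bound) (rule x_le)

text \<open>Second round of the bootstrap: \<open>p3_le\<close> makes \<open>p3\<close> a
  lower-order term of \<open>power_sums_le\<close>.\<close>

lemma p2_le: "p2 \<le> 1 / (real T - 2)"
proof -
  have "3 * p2 - 6 / T * p2 \<le> 3 / T" using power_sums_le p3_le by simp
  hence "(3 * p2 - 6 / T * p2) * T \<le> 3 / T * T" using T_pos by (intro mult_right_mono) auto
  hence "p2 * (real T - 2) \<le> 1" using T_pos by (simp add: algebra_simps)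
  thus ?thesis using T_large by (simp add: field_simps)
qed

text \<open>Cauchy--Schwarz over the edges at \<open>i\<close>: their link has weight
  \<open>3 * w\<close>, close to 1/2, while the squares of the pair products sum to at most
  \<open>p2\<^sup>2 / 2\<close>.\<close>

lemma degree_ge:
  assumes i: "i \<in> V"
  shows "(real T - 5)\<^sup>2 \<le> 2 * card {f. f \<in> E \<and> i \<in> f}"
proof -
  let ?d = "real (card {f. f \<in> E \<and> i \<in> f})"
  let ?L = "link_weight E (\<lambda>j. (x j)\<^sup>2) i"
  have CS: "(link_weight E x i)\<^sup>2 \<le> ?L * ?d"
    using sum_squared_le_sum_of_squares[of "\<lambda>f. \<Prod>j\<in>f - {i}. x j" "{f. f \<in> E \<and> i \<in> f}"]
    by (simp add: link_weight_def prod_power_distrib)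
  have "?L \<le> link_weight {f. f \<subseteq> V \<and> card f = Suc 2} (\<lambda>j. (x j)\<^sup>2) i"
    using finV E_sub by (intro link_weight_mono) auto
  also have "\<dots> = esym 2 (V - {i}) (\<lambda>j. (x j)\<^sup>2)" by (rule link_weight_ksubsets[OF finV i])
  also have "\<dots> \<le> p2\<^sup>2 / 2"
  proof -
    have "2 * esym 2 (V - {i}) (\<lambda>j. (x j)\<^sup>2) \<le> (p2 - (x i)\<^sup>2)\<^sup>2"
    proof -
      have "0 \<le> (\<Sum>j\<in>V - {i}. ((x j)\<^sup>2)\<^sup>2)" by (intro sum_nonneg) auto
      moreover have "(\<Sum>j\<in>V - {i}. (x j)\<^sup>2) = p2 - (x i)\<^sup>2"
        using finV i by (simp add: sum_diff1 p2_def)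
      ultimately show ?thesis using esym_2[of "V - {i}" "\<lambda>j. (x j)\<^sup>2"] finV by simp
    qed
    also have "\<dots> \<le> p2\<^sup>2" using sq_le_p2[OF i] by (intro power_mono) auto
    finally show ?thesis by simp
  qed
  finally have "?L * ?d \<le> p2\<^sup>2 / 2 * ?d" by (intro mult_right_mono) auto
  hence "(6 * w)\<^sup>2 \<le> p2\<^sup>2 * (2 * ?d)" using CS unfolding link[OF i] by (simp add: power_mult_distrib)
  also have "p2\<^sup>2 * (2 * ?d) \<le> (1 / (real T - 2))\<^sup>2 * (2 * ?d)"
    using p2_le p2_nonneg by (intro mult_right_mono power_mono) auto
  finally have "(6 * w)\<^sup>2 \<le> (1 / (real T - 2))\<^sup>2 * (2 * ?d)" .
  moreover have "(1 - 3 / T)\<^sup>2 \<le> (6 * w)\<^sup>2" using w_large T_large by (intro power_mono) auto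
  ultimately have "(1 - 3 / T)\<^sup>2 \<le> (1 / (real T - 2))\<^sup>2 * (2 * ?d)" by linarith
  hence "((1 - 3 / T) * (real T - 2))\<^sup>2 \<le> 2 * ?d"
    using T_large by (simp add: power_mult_distrib power_divide pos_le_divide_eq)
  moreover have "real T - 5 \<le> (1 - 3 / T) * (real T - 2)" using T_pos by (simp add: field_simps)
  hence "(real T - 5)\<^sup>2 \<le> ((1 - 3 / T) * (real T - 2))\<^sup>2" using T_large by (intro power_mono) auto
  ultimately show ?thesis by linarith
qed

section \<open>Bounds on the numbers of vertices, light vertices and missing triples\<close>

lemma sum_degrees:
  assumes "F \<subseteq> {f. f \<subseteq> V \<and> card f = 3}"
  shows "(\<Sum>i\<in>V. real (card {f. f \<in> F \<and> i \<in> f})) = 3 * card F"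
  using sum_link_weight[OF finV assms, of "\<lambda>_. 1"] by (simp add: link_weight_def)

lemma card_V_less: "real (card V) < real T + 12"
proof (rule ccontr)
  assume "\<not> ?thesis"
  hence "(real T + 12) * (real T - 5)\<^sup>2 \<le> card V * (real T - 5)\<^sup>2"
    by (intro mult_right_mono) auto
  also have "\<dots> \<le> (\<Sum>i\<in>V. 2 * real (card {f. f \<in> E \<and> i \<in> f}))"
    using sum_mono[of V "\<lambda>_. (real T - 5)\<^sup>2"] degree_ge by simp
  also have "\<dots> = 6 * real (card E)" using sum_degrees[OF E_sub] by (simp flip: sum_distrib_left)
  also have "\<dots> \<le> 6 * real ((T + 1) choose 3)" using card_E by simp
  also have "\<dots> \<le> real T ^ 3" unfolding six_choose_3 by simp
  \<comment> \<open>The left side expands to \<open>T^3 + 2 * T^2 - 95 * T + 300\<close>; the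
    quadratic coefficient 2 is \<open>12 - 2 * 5\<close>.\<close>
  finally have "2 * (real T * real T) + 300 \<le> 95 * real T"
    by (simp add: algebra_simps power2_eq_square power3_eq_cube)
  moreover have "10000 * real T \<le> real T * real T" using T_large by (intro mult_right_mono) auto
  ultimately show False using T_large by linarith
qed

text \<open>Second moment: in the squared deviations from \<open>1 / T\<close> the main terms
  cancel, leaving at most \<open>15 / T\<^sup>2\<close>, and each light vertex contributes at least
  \<open>1 / (2 * T)\<^sup>2\<close>.\<close>

lemma card_light: "real (card light) \<le> 60"
proof -
  let ?t = "real T"
  have "card light * (1 / (2 * ?t))\<^sup>2 = (\<Sum>i\<in>light. (1 / (2 * ?t))\<^sup>2)" by simp
  also have "\<dots> \<le> (\<Sum>i\<in>light. (x i - 1 / ?t)\<^sup>2)"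
  proof (rule sum_mono)
    fix i assume "i \<in> light"
    hence "1 / (2 * ?t) \<le> 1 / ?t - x i" by (simp add: light_def field_simps)
    hence "(1 / (2 * ?t))\<^sup>2 \<le> (1 / ?t - x i)\<^sup>2" by (intro power_mono) auto
    thus "(1 / (2 * ?t))\<^sup>2 \<le> (x i - 1 / ?t)\<^sup>2" by (simp add: power2_commute)
  qed
  also have "\<dots> \<le> (\<Sum>i\<in>V. (x i - 1 / ?t)\<^sup>2)"
    using finV by (intro sum_mono2) (auto simp: light_def)
  also have "\<dots> = p2 - 2 / ?t + card V / ?t\<^sup>2"
  proof -
    have "(\<Sum>i\<in>V. (x i - 1 / ?t)\<^sup>2) = (\<Sum>i\<in>V. (x i)\<^sup>2 - 2 / ?t * x i + 1 / ?t\<^sup>2)"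
      by (intro sum.cong) (auto simp: power2_diff power_divide)
    also have "\<dots> = p2 - 2 / ?t + card V / ?t\<^sup>2"
      by (simp add: sum.distrib sum_subtractf p2_def sum_x flip: sum_distrib_left sum_divide_distrib)
    finally show ?thesis .
  qed
  also have "\<dots> \<le> 1 / (?t - 2) - 2 / ?t + (?t + 12) / ?t\<^sup>2"
    using p2_le card_V_less by (intro add_mono diff_mono divide_right_mono) auto
  also have "\<dots> \<le> 15 / ?t\<^sup>2"
  proof -
    have "1 / (?t - 2) - 2 / ?t + (?t + 12) / ?t\<^sup>2 = (14 + 4 / (?t - 2)) / ?t\<^sup>2"
      using T_large by (simp add: field_simps power2_eq_square)
    moreover have "4 / (?t - 2) \<le> 1" using T_large by simp
    hence "(14 + 4 / (?t - 2)) / ?t\<^sup>2 \<le> 15 / ?t\<^sup>2" by (intro divide_right_mono) auto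
    ultimately show ?thesis by linarith
  qed
  finally show ?thesis using T_pos by (simp add: field_simps power2_eq_square)
qed

text \<open>A missing triple at \<open>i\<close> with no light vertex besides possibly
  \<open>i\<close> adds at least \<open>1 / (2 * T)\<^sup>2\<close> to a link of weight at most
  \<open>3 / (2 * T)\<close>, which allows \<open>6 * T\<close> of them. The others contain a light
  vertex besides \<open>i\<close>, and there are at most 60 choices for it.\<close>

lemma missing_degree_le:
  assumes i: "i \<in> V"
  shows "real (card {f. f \<in> M \<and> i \<in> f}) \<le> 70 * T"
proof -
  define A where "A = {f. f \<in> M \<and> i \<in> f \<and> (f - {i}) \<inter> light = {}}"
  have finA: "finite A" using finM by (simp add: A_def)
  have "card A * (1 / (2 * T))\<^sup>2 = (\<Sum>f\<in>A. (1 / (2 * T))\<^sup>2)" by simp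
  also have "\<dots> \<le> (\<Sum>f\<in>A. \<Prod>j\<in>f - {i}. x j)"
  proof (rule sum_mono)
    fix f assume f: "f \<in> A"
    hence f3: "f \<subseteq> V" "card f = 3" "i \<in> f" using M_sub by (auto simp: A_def)
    have "(1 / (2 * T))\<^sup>2 = (\<Prod>j\<in>f - {i}. 1 / (2 * real T))" using f3 by simp
    also have "\<dots> \<le> (\<Prod>j\<in>f - {i}. x j)"
    proof (rule prod_mono, rule conjI)
      fix j assume "j \<in> f - {i}"
      hence "j \<in> V - light" using f f3 by (auto simp: A_def)
      thus "1 / (2 * real T) \<le> x j" by (auto simp: light_def)
    qed simp
    finally show "(1 / (2 * T))\<^sup>2 \<le> (\<Prod>j\<in>f - {i}. x j)" .
  qed
  also have "\<dots> \<le> link_weight M x i"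
    unfolding link_weight_def using finM M_sub nonneg by (intro sum_mono2 prod_nonneg) (auto simp: A_def)
  also have "\<dots> \<le> 3 / (2 * T)"
  proof -
    have "x i * x i \<le> x i * 1" using x_le_1[OF i] nonneg[OF i] by (intro mult_left_mono)
    hence "2 * esym 2 (V - {i}) x \<le> 1" using two_esym_2[OF i] p2_nonneg by (simp add: power2_eq_square)
    thus ?thesis using link_M[OF i] w_large by simp
  qed
  finally have A: "card A \<le> 6 * real T" using T_pos by (simp add: field_simps power2_eq_square)
  let ?B = "\<lambda>j. {f. f \<subseteq> V \<and> card f = 3 \<and> i \<in> f \<and> j \<in> f}"
  have finL: "finite light" using finV by (simp add: light_def)
  have "{f. f \<in> M \<and> i \<in> f} \<subseteq> A \<union> (\<Union>j\<in>light - {i}. ?B j)"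
    using M_sub by (auto simp: A_def)
  hence "card {f. f \<in> M \<and> i \<in> f} \<le> card (A \<union> (\<Union>j\<in>light - {i}. ?B j))"
    using finA finL finV by (intro card_mono) auto
  also have "\<dots> \<le> card A + (\<Sum>j\<in>light - {i}. card (?B j))"
    using finL by (intro order_trans[OF card_Un_le] add_left_mono card_UN_le) auto
  also have "(\<Sum>j\<in>light - {i}. card (?B j)) \<le> (\<Sum>j\<in>light - {i}. card V)"
    using card_triples_containing_pair[OF finV, of i] by (intro sum_mono) auto
  also have "\<dots> = card (light - {i}) * card V" by simp
  also have "\<dots> \<le> card light * card V"
    using finL by (intro mult_right_mono card_mono) auto
  finally have "real (card {f. f \<in> M \<and> i \<in> f}) \<le> card A + real (card light) * card V"
    by (simp flip: of_nat_mult of_nat_add)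
  also have "real (card light) * card V \<le> 60 * (real T + 12)"
    using card_light card_V_less by (intro mult_mono) auto
  finally show ?thesis using A T_large by simp
qed

lemma p2_ge: "1 / card V \<le> p2"
proof -
  have "V \<noteq> {}" using sum_x by auto
  moreover have "(\<Sum>i\<in>V. x i)\<^sup>2 \<le> p2 * card V"
    unfolding p2_def by (rule sum_squared_le_sum_of_squares)
  ultimately show ?thesis using finV by (simp add: sum_x field_simps card_gt_0_iff)
qed

text \<open>The lower bound \<open>1 / (T + 12)\<close> on \<open>p2\<close> cancels the main term
  \<open>3 / T\<close>; what is left, like \<open>p3\<close>, is of order
  \<open>1 / T\<^sup>2\<close>.\<close>

lemma Mx_le: "Mx \<le> 8 / (real T)\<^sup>2"
proof -
  let ?t = "real T"
  have V: "V \<noteq> {}" using sum_x by auto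
  have "1 / (?t + 12) \<le> 1 / card V" using card_V_less V finV by (intro divide_left_mono) (auto simp: card_gt_0_iff)
  hence "1 / (?t + 12) \<le> p2" using p2_ge by linarith
  moreover have "p3 \<le> 3 / ?t * (1 / (?t - 2))"
    using p3_le mult_left_mono[OF p2_le, of "3 / ?t"] by simp
  moreover have "6 * Mx \<le> 3 / T - 3 * p2 + 2 * p3" using Mx_eq six_esym_3 w_large by linarith
  ultimately have "6 * Mx \<le> 3 / ?t - 3 * (1 / (?t + 12)) + 2 * (3 / ?t * (1 / (?t - 2)))" by linarith
  also have "3 / ?t - 3 * (1 / (?t + 12)) = 36 / (?t * (?t + 12))"
    using T_large by (simp add: field_simps)
  also have "\<dots> \<le> 36 / ?t\<^sup>2"
    using T_large by (intro divide_left_mono) (auto simp: power2_eq_square)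
  also have "2 * (3 / ?t * (1 / (?t - 2))) \<le> 12 / ?t\<^sup>2"
    using T_large by (simp add: field_simps power2_eq_square)
  finally show ?thesis by simp
qed

text \<open>\<open>Mx_le\<close> allows \<open>64 * T\<close> missing triples free of light
  vertices, and each of the at most 60 light vertices lies in at most \<open>70 * T\<close>
  more.\<close>

lemma card_M_le: "real (card M) \<le> 4300 * T"
proof -
  define A where "A = {f \<in> M. f \<inter> light = {}}"
  have fin: "finite A" "finite light" using finM finV by (auto simp: A_def light_def)
  have "card A * (1 / (2 * T))^3 = (\<Sum>f\<in>A. (1 / (2 * T))^3)" by simp
  also have "\<dots> \<le> (\<Sum>f\<in>A. \<Prod>j\<in>f. x j)"
  proof (rule sum_mono)
    fix f assume f: "f \<in> A"
    hence f3: "f \<subseteq> V" "card f = 3" using M_sub by (auto simp: A_def)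
    have "(1 / (2 * T))^3 = (\<Prod>j\<in>f. 1 / (2 * real T))" using f3 by simp
    also have "\<dots> \<le> (\<Prod>j\<in>f. x j)"
    proof (rule prod_mono, rule conjI)
      fix j assume "j \<in> f"
      hence "j \<in> V - light" using f f3 by (auto simp: A_def)
      thus "1 / (2 * real T) \<le> x j" by (auto simp: light_def)
    qed simp
    finally show "(1 / (2 * T))^3 \<le> (\<Prod>j\<in>f. x j)" .
  qed
  also have "\<dots> \<le> Mx"
    unfolding Mx_def using finM M_sub nonneg by (intro sum_mono2 prod_nonneg) (auto simp: A_def)
  also note Mx_le
  finally have A: "card A \<le> 64 * real T" using T_pos by (simp add: field_simps power2_eq_square power3_eq_cube)
  let ?B = "\<lambda>j. {f. f \<in> M \<and> j \<in> f}"
  have "M \<subseteq> A \<union> (\<Union>j\<in>light. ?B j)" by (auto simp: A_def)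
  hence "card M \<le> card (A \<union> (\<Union>j\<in>light. ?B j))"
    using fin finM by (intro card_mono) auto
  also have "\<dots> \<le> card A + (\<Sum>j\<in>light. card (?B j))"
    using fin by (intro order_trans[OF card_Un_le] add_left_mono card_UN_le) auto
  finally have "real (card M) \<le> card A + (\<Sum>j\<in>light. real (card (?B j)))"
    by (simp flip: of_nat_sum of_nat_add)
  also have "(\<Sum>j\<in>light. real (card (?B j))) \<le> card light * (70 * real T)"
    using sum_bounded_above[of light "\<lambda>j. real (card (?B j))" "70 * real T"] missing_degree_le
    by (auto simp: light_def)
  also have "\<dots> \<le> 60 * (70 * real T)" using card_light by (intro mult_right_mono) auto
  finally show ?thesis using A by simp
qed

lemma card_M: "card E + card M = card V choose 3"
proof -
  have "card M = (card V choose 3) - card E"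
    unfolding M_def using finV E_sub finE by (simp add: card_Diff_subset n_subsets)
  moreover have "card E \<le> card V choose 3"
    using card_mono[OF _ E_sub] finV by (simp add: n_subsets)
  ultimately show ?thesis by simp
qed

lemma card_V_le: "card V \<le> T + 1"
proof (rule ccontr)
  assume "\<not> ?thesis"
  hence "(T + 1 + 1) choose 3 \<le> card V choose 3" by (intro binomial_right_mono) auto
  hence "real ((T + 1 + 1) choose 3) \<le> card E + card M" using card_M by simp
  hence "6 * real ((T + 1 + 1) choose 3) \<le> 6 * real ((T + 1) choose 3) + 6 * (4300 * T)"
    using card_E card_M_le by (simp add: of_nat_le_iff[symmetric, where ?'a = real] del: of_nat_le_iff)
  \<comment> \<open>A vertex beyond \<open>T + 1\<close> forces quadratically many missing triples
    against the linear bound. This inequality fails from \<open>T = 8600\<close> on, which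
    \<open>T_large\<close> covers.\<close>
  hence "3 * (real T * real T) + 3 * real T \<le> 25800 * real T"
    unfolding six_choose_3 by (simp add: algebra_simps power3_eq_cube)
  moreover have "10000 * real T \<le> real T * real T" using T_large by (intro mult_right_mono) auto
  ultimately show False using T_large by linarith
qed

end

text \<open>Without the triples through both \<open>a\<close> and \<open>b\<close>, the polynomial
  depends on \<open>x a\<close> and \<open>x b\<close> only through their sum, so \<open>a\<close>
  can be merged into \<open>b\<close>.\<close>

lemma esym_3_merge:
  assumes "finite V" "a \<in> V" "b \<in> V" "a \<noteq> b"
  shows "esym 3 V x - x a * x b * (\<Sum>i\<in>V - {a, b}. x i) = esym 3 (V - {a}) (x(b := x a + x b))"
proof -
  let ?W = "V - {a, b}" and ?y = "x(b := x a + x b)"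
  have W: "V - {a} - {b} = ?W" by auto
  have "esym 3 V x = esym 3 (V - {a}) x + x a * esym 2 (V - {a}) x"
    using esym_Suc_remove[of V a 2 x] assms by (simp add: numeral_3_eq_3 numeral_2_eq_2)
  moreover have "esym 2 (V - {a}) x = esym 2 ?W x + x b * (\<Sum>i\<in>?W. x i)"
    using esym_Suc_remove[of "V - {a}" b 1 x] esym_1[of ?W x] assms W by (simp add: numeral_2_eq_2)
  moreover have "esym 3 (V - {a}) z = esym 3 ?W z + z b * esym 2 ?W z" for z :: "'a \<Rightarrow> real"
    using esym_Suc_remove[of "V - {a}" b 2 z] assms W by (simp add: numeral_3_eq_3 numeral_2_eq_2)
  moreover have "esym k ?W ?y = esym k ?W x" for k by (rule esym_cong) auto
  ultimately show ?thesis by (simp add: algebra_simps)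
qed

text \<open>Starting from \<open>A\<close>, deleting a heaviest element never raises the average;
  the averages are cleared of denominators.\<close>

lemma light_subset_exists:
  fixes x :: "'a \<Rightarrow> real"
  assumes "finite A" "r \<le> card A"
  shows "\<exists>R\<subseteq>A. card R = r \<and> card A * (\<Sum>i\<in>R. x i) \<le> r * (\<Sum>i\<in>A. x i)"
  using assms(2)
proof (induction rule: inc_induct)
  case base
  show ?case by auto
next
  case (step r)
  then obtain R where R: "R \<subseteq> A" "card R = Suc r"
    "card A * (\<Sum>i\<in>R. x i) \<le> Suc r * (\<Sum>i\<in>A. x i)" by auto
  have fin: "finite R" "R \<noteq> {}" using R by (auto intro: card_ge_0_finite)
  obtain m where m: "m \<in> R" "\<And>i. i \<in> R \<Longrightarrow> x i \<le> x m"
    using obtains_MAX[OF fin, of x] by (metis Max_ge finite_imageI fin(1) image_eqI)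
  let ?s = "\<Sum>i\<in>R. x i"
  have "?s \<le> Suc r * x m" using sum_bounded_above[of R x "x m"] m R by simp
  hence "Suc r * (?s - x m) \<le> r * ?s" by (simp add: algebra_simps)
  hence "card A * (Suc r * (?s - x m)) \<le> card A * (r * ?s)" by (intro mult_left_mono) auto
  also have "\<dots> = r * (card A * ?s)" by simp
  also have "\<dots> \<le> r * (Suc r * (\<Sum>i\<in>A. x i))" using R(3) by (intro mult_left_mono) auto
  finally have "Suc r * (card A * (?s - x m)) \<le> Suc r * (r * (\<Sum>i\<in>A. x i))"
    by (simp add: mult_ac)
  hence "card A * (?s - x m) \<le> r * (\<Sum>i\<in>A. x i)"
    by (rule mult_left_le_imp_le) simp
  moreover have "(\<Sum>i\<in>R - {m}. x i) = ?s - x m" using m fin by (simp add: sum_diff1)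
  ultimately show ?case using R m fin by (intro exI[of _ "R - {m}"]) auto
qed

section \<open>Comparison with the colex graph\<close>

context near_clique_optimum
begin

text \<open>For \<open>card V = T + 1\<close>, the reference weight \<open>1 / (T - 1)\<close>
  bounds the average weight outside the two lightest vertices.\<close>

definition deficit :: "'a \<Rightarrow> real" where "deficit i = max 0 (1 - (real T - 1) * x i)"

lemma deficit_nonneg: "0 \<le> deficit i" by (simp add: deficit_def)

text \<open>By \<open>link_M\<close>, a vertex of small weight has a missing link that makes up for
  its shortfall, up to lower order. The missing links together weigh only \<open>O(1 / T)\<close>:
  there are \<open>O(T)\<close> missing triples and all weights are \<open>O(1 / T)\<close>.\<close>

lemma sum_deficit_le:
  assumes n: "card V = T + 1"
  shows "(\<Sum>i\<in>V. deficit i) \<le> 120000"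
proof -
  let ?t = "real T"
  have le: "deficit i \<le> 5 / ?t + ?t * link_weight M x i" if i: "i \<in> V" for i
  proof -
    have "1 - 3 * p2 + 2 * p3 \<ge> 6 * w" using six_esym_3 w_le_esym by simp
    hence "link_weight M x i \<ge> p2 - p3 - x i"
      using link_M[OF i] two_esym_2[OF i] zero_le_power2[of "x i"] by linarith
    moreover have "(1 - 3 / ?t) * p2 \<le> p2 - p3" using p3_le by (simp add: algebra_simps)
    moreover have "(1 - 3 / ?t) * (1 / (?t + 1)) \<le> (1 - 3 / ?t) * p2"
      using p2_ge n T_large by (intro mult_left_mono) (auto simp: add_ac)
    ultimately have "(1 - 3 / ?t) * (1 / (?t + 1)) \<le> link_weight M x i + x i" by linarith
    hence "(?t - 1) * ((1 - 3 / ?t) * (1 / (?t + 1))) \<le> (?t - 1) * (link_weight M x i + x i)"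
      using T_large by (intro mult_left_mono) auto
    also have "\<dots> \<le> ?t * link_weight M x i + (?t - 1) * x i"
      using link_M_nonneg[of i] by (simp add: algebra_simps)
    finally have "(?t - 1) * ((1 - 3 / ?t) * (1 / (?t + 1))) \<le> ?t * link_weight M x i + (?t - 1) * x i" .
    moreover have "1 - 5 / ?t \<le> (?t - 1) * ((1 - 3 / ?t) * (1 / (?t + 1)))"
    proof -
      have "(?t - 1) * ((1 - 3 / ?t) * (1 / (?t + 1))) = 1 - 5 / ?t + 8 / (?t * (?t + 1))"
        using T_large by (simp add: divide_simps) (simp add: algebra_simps)
      thus ?thesis by simp
    qed
    ultimately have "1 - (?t - 1) * x i \<le> 5 / ?t + ?t * link_weight M x i" by linarith
    thus ?thesis using link_M_nonneg[of i] by (simp add: deficit_def)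
  qed
  have "link_weight M x i \<le> real (card {f. f \<in> M \<and> i \<in> f}) * (3 / ?t)\<^sup>2" if i: "i \<in> V" for i
    unfolding link_weight_def
  proof (rule sum_bounded_above)
    fix f assume "f \<in> {f. f \<in> M \<and> i \<in> f}"
    hence f: "f \<subseteq> V" "card f = 3" "i \<in> f" using M_sub by auto
    have "(\<Prod>j\<in>f - {i}. x j) \<le> (\<Prod>j\<in>f - {i}. 3 / ?t)"
      using f x_le nonneg by (intro prod_mono) auto
    thus "(\<Prod>j\<in>f - {i}. x j) \<le> (3 / ?t)\<^sup>2" using f by simp
  qed
  hence "(\<Sum>i\<in>V. link_weight M x i) \<le> (\<Sum>i\<in>V. real (card {f. f \<in> M \<and> i \<in> f}) * (3 / ?t)\<^sup>2)"
    by (intro sum_mono)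
  also have "\<dots> = 3 * real (card M) * (3 / ?t)\<^sup>2"
    using sum_degrees[OF M_sub] by (simp flip: sum_distrib_right)
  also have "\<dots> \<le> 3 * (4300 * ?t) * (3 / ?t)\<^sup>2"
    using card_M_le by (intro mult_right_mono) auto
  finally have M: "(\<Sum>i\<in>V. link_weight M x i) \<le> 116100 / ?t"
    using T_pos by (simp add: field_simps power2_eq_square)
  have "(\<Sum>i\<in>V. deficit i) \<le> (\<Sum>i\<in>V. 5 / ?t + ?t * link_weight M x i)" using le by (rule sum_mono)
  also have "\<dots> = (?t + 1) * (5 / ?t) + ?t * (\<Sum>i\<in>V. link_weight M x i)"
    using n by (simp add: sum.distrib sum_distrib_left)
  also have "\<dots> \<le> 10 + ?t * (116100 / ?t)"
    using M T_large by (intro add_mono mult_left_mono) (auto simp: field_simps)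
  finally show ?thesis using T_pos by simp
qed

text \<open>The subtracted product is a substitute for the indicator of the triples whose three deficits
  all exceed \<open>h\<close>: it is at least \<open>h\<^sup>2\<close> times a deficit there, and its sum over all triples is bounded.\<close>

lemma missing_triple_weight:
  fixes h :: real
  assumes f: "f \<in> M" and h: "0 < h"
    and a: "a \<in> V" "\<And>i. i \<in> V \<Longrightarrow> x a \<le> x i"
    and b: "b \<in> V" "\<And>i. i \<in> V - {a} \<Longrightarrow> x b \<le> x i"
  shows "x a * x b * (1 - h - (\<Prod>i\<in>f. deficit i) / h\<^sup>2) \<le> (real T - 1) * (\<Prod>i\<in>f. x i)"
proof -
  have f3: "f \<subseteq> V" "card f = 3" using f M_sub by auto
  hence finf: "finite f" using finV by (auto intro: finite_subset)
  have pair: "x a * x b \<le> x p * x q" if "p \<in> V" "q \<in> V" "p \<noteq> q" for p q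
  \<comment> \<open>If \<open>q = a\<close>, then \<open>p\<close> differs from \<open>a\<close> and
    is compared with \<open>b\<close>; otherwise \<open>q\<close> is.\<close>
  proof (cases "q = a")
    case True
    hence "x b * x a \<le> x p * x q" using that a b nonneg by (intro mult_mono) auto
    thus ?thesis by (simp add: mult.commute)
  next
    case False
    thus ?thesis using that a b nonneg by (intro mult_mono) auto
  qed
  \<comment> \<open>\<open>u\<close> takes the role of \<open>i\<close> in \<open>{i, a, b}\<close>,
    and the other two vertices are compared with \<open>a\<close> and \<open>b\<close>. If all
    deficits exceed \<open>h\<close>, any \<open>u\<close> will do.\<close>
  have "\<exists>u\<in>f. deficit u \<le> h + (\<Prod>i\<in>f. deficit i) / h\<^sup>2"
  proof (cases "\<exists>u\<in>f. deficit u \<le> h")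
    case True
    moreover have "0 \<le> (\<Prod>i\<in>f. deficit i) / h\<^sup>2" using deficit_nonneg by (simp add: prod_nonneg)
    ultimately show ?thesis by (meson add_increasing2 order_trans)
  next
    case False
    obtain u where u: "u \<in> f" using f3 by fastforce
    have "h\<^sup>2 * deficit u = (\<Prod>i\<in>f - {u}. h) * deficit u" using f3 u by simp
    also have "\<dots> \<le> (\<Prod>i\<in>f - {u}. deficit i) * deficit u"
      using False h deficit_nonneg by (intro mult_right_mono prod_mono) (auto simp: not_le less_imp_le)
    also have "\<dots> = (\<Prod>i\<in>f. deficit i)" using u finf by (simp add: prod.remove mult.commute)
    finally have "deficit u \<le> (\<Prod>i\<in>f. deficit i) / h\<^sup>2" using h by (simp add: field_simps)
    thus ?thesis using u h by (intro bexI[of _ u]) auto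
  qed
  then obtain u where u: "u \<in> f" "deficit u \<le> h + (\<Prod>i\<in>f. deficit i) / h\<^sup>2" by auto
  have "card (f - {u}) = 2" using f3 u by simp
  then obtain p q where pq: "f - {u} = {p, q}" "p \<noteq> q" by (auto simp: card_2_iff)
  have "p \<in> V" "q \<in> V" "u \<in> V" using pq f3 u by auto
  have "1 - h - (\<Prod>i\<in>f. deficit i) / h\<^sup>2 \<le> (real T - 1) * x u"
    using u(2) by (simp add: deficit_def)
  hence "x a * x b * (1 - h - (\<Prod>i\<in>f. deficit i) / h\<^sup>2) \<le> x a * x b * ((real T - 1) * x u)"
    using a b nonneg by (intro mult_left_mono) auto
  also have "\<dots> \<le> x p * x q * ((real T - 1) * x u)"
    using pair \<open>p \<in> V\<close> \<open>q \<in> V\<close> \<open>u \<in> V\<close> pq nonneg T_large by (intro mult_right_mono) auto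
  also have "x p * x q = (\<Prod>i\<in>f - {u}. x i)" using pq by simp
  also have "\<dots> * ((real T - 1) * x u) = (real T - 1) * (\<Prod>i\<in>f. x i)"
    using u(1) finf by (simp add: prod.remove mult_ac)
  finally show ?thesis .
qed

text \<open>Sum of \<open>missing_triple_weight\<close> over \<open>M\<close>. The products of
  deficits sum to at most \<open>esym 3 V deficit\<close>, hence to at most the cube of the bounded
  total deficit.\<close>

lemma Mx_ge:
  fixes h :: real
  assumes n: "card V = T + 1" and h: "0 < h"
    and a: "a \<in> V" "\<And>i. i \<in> V \<Longrightarrow> x a \<le> x i"
    and b: "b \<in> V" "\<And>i. i \<in> V - {a} \<Longrightarrow> x b \<le> x i"
  shows "x a * x b * (real (card M) - h * real (card M) - 120000 ^ 3 / h\<^sup>2) \<le> (real T - 1) * Mx"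
proof -
  have "(\<Sum>f\<in>M. \<Prod>i\<in>f. deficit i) \<le> esym 3 V deficit"
    by (rule sum_prod_le_esym[OF finV M_sub]) (rule deficit_nonneg)
  also have "\<dots> \<le> (\<Sum>i\<in>V. deficit i) ^ 3" by (rule esym_3_le_cube[OF finV deficit_nonneg])
  also have "\<dots> \<le> 120000 ^ 3"
    using sum_deficit_le[OF n] deficit_nonneg by (intro power_mono sum_nonneg)
  finally have D: "(\<Sum>f\<in>M. \<Prod>i\<in>f. deficit i) / h\<^sup>2 \<le> 120000 ^ 3 / h\<^sup>2"
    by (rule divide_right_mono) simp
  have "x a * x b * (real (card M) - h * real (card M) - 120000 ^ 3 / h\<^sup>2)
      \<le> x a * x b * (real (card M) - h * real (card M) - (\<Sum>f\<in>M. \<Prod>i\<in>f. deficit i) / h\<^sup>2)"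
    using D a b nonneg by (intro mult_left_mono) auto
  also have "\<dots> = (\<Sum>f\<in>M. x a * x b * (1 - h - (\<Prod>i\<in>f. deficit i) / h\<^sup>2))"
  proof -
    have "(\<Sum>f\<in>M. 1 - h - (\<Prod>i\<in>f. deficit i) / h\<^sup>2)
        = real (card M) - h * real (card M) - (\<Sum>f\<in>M. \<Prod>i\<in>f. deficit i) / h\<^sup>2"
      by (simp add: sum_subtractf sum.distrib sum_divide_distrib algebra_simps)
    thus ?thesis by (simp only: flip: sum_distrib_left)
  qed
  also have "\<dots> \<le> (\<Sum>f\<in>M. (real T - 1) * (\<Prod>i\<in>f. x i))"
    by (intro sum_mono missing_triple_weight) (use assms in auto)
  finally show ?thesis by (simp add: Mx_def sum_distrib_left)
qed

lemma le_lagrangian_colex: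
  fixes h :: real
  assumes n: "card V = T + 1" and h: "0 < h" and kT: "T choose 3 \<le> k"
    and k: "card E + h * card M + 120000 ^ 3 / h\<^sup>2 + 1 \<le> real k"
  shows "w \<le> lagrangian (colex_graph k)"
proof -
  have "V \<noteq> {}" using sum_x by auto
  obtain a where a: "a \<in> V" "\<And>i. i \<in> V \<Longrightarrow> x a \<le> x i"
    using ex_min_if_finite[of "x ` V"] finV \<open>V \<noteq> {}\<close> by (force simp: not_less)
  have Va: "card (V - {a}) = T" using n a finV by simp
  hence "V - {a} \<noteq> {}" using T_large by (metis card.empty not_numeral_le_zero)
  then obtain b where b: "b \<in> V - {a}" "\<And>i. i \<in> V - {a} \<Longrightarrow> x b \<le> x i"
    using ex_min_if_finite[of "x ` (V - {a})"] finV by (force simp: not_less)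
  let ?W = "V - {a, b}"
  have W: "?W = V - {a} - {b}" by auto
  have cW: "card ?W = T - 1" unfolding W using b Va finV by simp
  define c where "c = real (card M) - h * real (card M) - 120000 ^ 3 / h\<^sup>2"
  \<comment> \<open>Only \<open>T - 1\<close> triples contain both \<open>a\<close> and
    \<open>b\<close>, hence the cap. For negative \<open>c\<close> the conversion gives
    \<open>r = 0\<close>, where \<open>Mx_nonneg\<close> suffices.\<close>
  define r where "r = min (T - 1) (nat \<lfloor>c\<rfloor>)"
  obtain R where R: "R \<subseteq> ?W" "card R = r" "card ?W * (\<Sum>i\<in>R. x i) \<le> r * (\<Sum>i\<in>?W. x i)"
    using light_subset_exists[of ?W r x] finV cW by (auto simp: r_def)
  have "(\<Sum>i\<in>?W. x i) \<le> (\<Sum>i\<in>V. x i)" using finV nonneg by (intro sum_mono2) auto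
  hence "real r * (\<Sum>i\<in>?W. x i) \<le> real r * 1" unfolding sum_x by (intro mult_left_mono) auto
  hence R': "(real T - 1) * (\<Sum>i\<in>R. x i) \<le> r" using R(3) cW T_large by (simp add: of_nat_diff)
  have ab0: "0 \<le> x a * x b" using a b nonneg by auto
  have "x a * x b * (\<Sum>i\<in>R. x i) \<le> Mx"
  proof (cases "r = 0")
    case True
    hence "R = {}" using R finV finite_subset[of R ?W] by auto
    thus ?thesis using Mx_nonneg by simp
  next
    case False
    hence "real r \<le> c" by (simp add: r_def) linarith
    have "(real T - 1) * (x a * x b * (\<Sum>i\<in>R. x i)) = x a * x b * ((real T - 1) * (\<Sum>i\<in>R. x i))" by simp
    also have "\<dots> \<le> x a * x b * c" using R' \<open>real r \<le> c\<close> ab0 by (intro mult_left_mono) auto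
    also have "\<dots> \<le> (real T - 1) * Mx" unfolding c_def using n h a b by (intro Mx_ge) auto
    finally show ?thesis using T_large by simp
  qed
  hence w: "w \<le> esym 3 V x - x a * x b * (\<Sum>i\<in>R. x i)" using Mx_eq by simp
  show ?thesis
  proof (cases "r = T - 1")
    \<comment> \<open>\<open>weight_le_lagrangian_colex\<close> would need
      \<open>r + 3 \<le> T + 1\<close>, which fails. But now all triples through \<open>a\<close>
      and \<open>b\<close> are gone, and merging leaves a clique on \<open>T\<close> vertices, which
      fits by \<open>kT\<close>.\<close>
    case True
    hence "R = ?W" using R cW finV by (intro card_subset_eq) auto
    hence "w \<le> esym 3 (V - {a}) (x(b := x a + x b))"
      using w esym_3_merge[OF finV, of a b x] a b by auto
    also have "\<dots> \<le> lagrangian (colex_graph k)"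
    proof (rule esym_3_le_lagrangian_colex)
      show "finite (V - {a})" "card (V - {a}) choose 3 \<le> k" "3 \<le> card (V - {a})"
        using finV kT Va T_large by auto
      show "0 \<le> (x(b := x a + x b)) i" if "i \<in> V - {a}" for i using that a b nonneg by auto
      have "(\<Sum>i\<in>V - {a} - {b}. (x(b := x a + x b)) i) = (\<Sum>i\<in>V - {a} - {b}. x i)"
        by (intro sum.cong) auto
      thus "(\<Sum>i\<in>V - {a}. (x(b := x a + x b)) i) = 1"
        using a b finV sum_x sum.remove[of V a x] sum.remove[of "V - {a}" b x]
          sum.remove[of "V - {a}" b "x(b := x a + x b)"] by simp
    qed
    finally show ?thesis .
  next
    case False
    hence r: "r = nat \<lfloor>c\<rfloor>" "r < T - 1" by (auto simp: r_def)
    \<comment> \<open>The loss from rounding is paid for by the \<open>+ 1\<close> in the bound on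
      \<open>k\<close>.\<close>
    have "c - 1 \<le> real r" unfolding r by linarith
    hence "real (card E) + card M \<le> real k + r" using k unfolding c_def by linarith
    hence "(card V choose 3) - card R \<le> k" using card_M R(2) by linarith
    thus ?thesis
      using weight_le_lagrangian_colex[OF finV a(1), of b R k x] w a b R r n nonneg sum_x by force
  qed
qed

end

section \<open>Reduction to the support, and the choice of constants\<close>

lemma optimal_weighting_exists:
  assumes "m > 0"
  obtains V :: "nat set" and E x where "finite V" "E \<subseteq> {f. f \<subseteq> V \<and> card f = 3}" "card E \<le> m"
    "\<And>i. i \<in> V \<Longrightarrow> 0 < x i" "(\<Sum>i\<in>V. x i) = 1" "lambda3 m = (\<Sum>f\<in>E. \<Prod>i\<in>f. x i)"
    "\<And>i. i \<in> V \<Longrightarrow> link_weight E x i = 3 * lambda3 m"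
proof -
  obtain H :: "nat hypergraph" where H: "three_graph H" "card (edges H) = m" "lagrangian H = lambda3 m"
    using lambda3_attained(1)[OF assms] by auto
  have finH: "finite (verts H)" "finite (edges H)"
    using H(1) three_graph_finite_edges[OF H(1)] by (simp_all add: three_graph_def)
  have "edges H \<noteq> {}" using H(2) assms by auto
  hence ne: "verts H \<noteq> {}" using H(1) by (fastforce simp: three_graph_def)
  obtain x where x: "legal_weighting H x" "weight H x = lambda3 m"
    using lagrangian_attained(1)[OF H(1) ne] H(3) by auto
  \<comment> \<open>On the support all weights are positive, as \<open>link_weight_optimal\<close>
    requires. The edges lost have weight 0, but only \<open>card E \<le> m\<close> remains.\<close>
  define V where "V = {i \<in> verts H. 0 < x i}"
  define E where "E = {f \<in> edges H. f \<subseteq> V}"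
  have sub: "V \<subseteq> verts H" "E \<subseteq> edges H" by (auto simp: V_def E_def)
  have V: "finite V" "E \<subseteq> {f. f \<subseteq> V \<and> card f = 3}"
    using finH H(1) by (auto simp: V_def E_def three_graph_def)
  have cE: "card E \<le> m" using H(2) finH sub by (metis card_mono)
  have x0: "x i = 0" if "i \<in> verts H - V" for i
    using that x(1) by (force simp: V_def legal_weighting_def)
  have sx: "(\<Sum>i\<in>V. x i) = 1"
    using sum.mono_neutral_left[OF finH(1) sub(1), of x] x0 x(1) by (auto simp: legal_weighting_def)
  have wx: "lambda3 m = (\<Sum>f\<in>E. \<Prod>i\<in>f. x i)"
    unfolding x(2)[symmetric] weight_def
  proof (rule sum.mono_neutral_right[OF finH(2) sub(2)], rule ballI)
    fix f assume f: "f \<in> edges H - E"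
    hence f': "f \<subseteq> verts H" "finite f" using H(1) finH by (auto simp: three_graph_def intro: finite_subset)
    obtain i where "i \<in> f" "i \<notin> V" using f by (auto simp: E_def)
    thus "(\<Prod>i\<in>f. x i) = 0" using f' x0 by (intro prod_zero) auto
  qed
  have opt: "(\<Sum>f\<in>E. \<Prod>j\<in>f. y j) \<le> (\<Sum>f\<in>E. \<Prod>j\<in>f. x j)"
    if y: "\<And>i. i \<in> V \<Longrightarrow> 0 \<le> y i" "(\<Sum>i\<in>V. y i) = 1" for y
  proof -
    define z where "z i = (if i \<in> V then y i else 0)" for i
    have z0: "0 \<le> z i" for i using y by (simp add: z_def)
    have "(\<Sum>i\<in>verts H. z i) = (\<Sum>i\<in>V. y i)"
      using sum.mono_neutral_right[OF finH(1) sub(1), of z] by (auto simp: z_def)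
    hence "weight H z \<le> lambda3 m"
      using lagrangian_attained(2)[OF H(1) ne, of z] y z0 H(3) by (simp add: legal_weighting_def)
    moreover have "(\<Sum>f\<in>E. \<Prod>j\<in>f. z j) \<le> weight H z"
      unfolding weight_def using finH sub z0 by (intro sum_mono2 prod_nonneg) auto
    moreover have "(\<Sum>f\<in>E. \<Prod>j\<in>f. z j) = (\<Sum>f\<in>E. \<Prod>j\<in>f. y j)"
      by (intro sum.cong prod.cong) (auto simp: z_def E_def)
    ultimately show ?thesis using wx by simp
  qed
  have pos: "0 < x i" if "i \<in> V" for i using that by (simp add: V_def)
  show ?thesis
    by (rule that[OF V cE pos sx wx]) (auto simp: wx intro: link_weight_optimal[OF V pos sx opt])
qed

lemma lambda3_pos:
  assumes "m > 0"
  shows "0 < lambda3 m"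
proof -
  have "1 - 3 / 3 + 2 / 3\<^sup>2 \<le> 6 * lagrangian (colex_graph m)"
    using uniform_le_lagrangian_colex[of 3 m] assms by simp
  moreover have "lagrangian (colex_graph m) \<le> lambda3 m"
    using assms by (intro lambda3_attained(2) three_graph_colex_graph) (auto simp: colex_graph_def card_colex_edges)
  ultimately show ?thesis by simp
qed

text \<open>A positive derivative puts every vertex of the support into an edge, so the support has
  at most \<open>3 * m\<close> vertices. This crude bound serves the finitely many small
  \<open>m\<close>.\<close>

lemma lambda3_le_colex_trivial:
  assumes m: "m > 0" and k: "(3 * m) choose 3 \<le> k"
  shows "lambda3 m \<le> lagrangian (colex_graph k)"
proof -
  obtain V :: "nat set" and E x where V: "finite V" "E \<subseteq> {f. f \<subseteq> V \<and> card f = 3}" "card E \<le> m"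
    and x: "\<And>i. i \<in> V \<Longrightarrow> 0 < x i" "(\<Sum>i\<in>V. x i) = 1" "lambda3 m = (\<Sum>f\<in>E. \<Prod>i\<in>f. x i)"
    and link: "\<And>i. i \<in> V \<Longrightarrow> link_weight E x i = 3 * lambda3 m"
    using optimal_weighting_exists[OF m] by blast
  have "i \<in> \<Union>E" if "i \<in> V" for i
  proof (rule ccontr)
    assume "i \<notin> \<Union>E"
    hence "link_weight E x i = 0" unfolding link_weight_def by (intro sum.neutral) auto
    thus False using link[OF that] lambda3_pos[OF m] by simp
  qed
  hence "V \<subseteq> \<Union>E" by blast
  hence "card V \<le> card (\<Union>E)"
  proof (intro card_mono)
    have "\<Union>E \<subseteq> V" using V(2) by auto
    thus "finite (\<Union>E)" using V(1) by (rule finite_subset)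
  qed
  also have "\<dots> \<le> (\<Sum>f\<in>E. card f)" by (rule card_Union_le_sum_card)
  also have "\<dots> = 3 * card E" using V(2) by (simp add: subset_iff)
  finally have "card V \<le> 3 * m" using V(3) by simp
  hence "card V choose 3 \<le> k" using k binomial_right_mono order_trans by blast
  moreover have "3 \<le> card V"
  proof -
    have "E \<noteq> {}" using x(3) lambda3_pos[OF m] by auto
    then obtain f where "f \<subseteq> V" "card f = 3" using V(2) by blast
    thus ?thesis using card_mono[OF V(1)] by metis
  qed
  ultimately have "esym 3 V x \<le> lagrangian (colex_graph k)"
    using V x by (intro esym_3_le_lagrangian_colex) (auto simp: less_imp_le)
  moreover have "lambda3 m \<le> esym 3 V x"
    unfolding x(3) using x(1) by (intro sum_prod_le_esym V) (auto simp: less_imp_le)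
  ultimately show ?thesis by simp
qed

lemma lambda3_le_colex_large:
  assumes T: "10000 \<le> T" "T choose 3 < m" "m \<le> (T + 1) choose 3"
    and k: "real m + (9000 + 120000 ^ 3) * real m powr (2 / 9) \<le> real k"
  shows "lambda3 m \<le> lagrangian (colex_graph k)"
proof -
  have m: "m > 0" using T(2) by simp
  have mk: "m \<le> k"
  proof -
    have "0 \<le> (9000 + 120000 ^ 3) * real m powr (2 / 9)" by simp
    hence "real m \<le> real k" using k by linarith
    thus ?thesis by simp
  qed
  hence kT: "T choose 3 \<le> k" using T by simp
  show ?thesis
  proof (cases "1 - 3 / T \<le> 6 * lambda3 m")
    case False
    \<comment> \<open>Here the uniform clique on \<open>T\<close> vertices, which fits into the
      first \<open>k\<close> triples, already wins.\<close>
    have "0 \<le> 2 / (real T)\<^sup>2" by simp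
    thus ?thesis using False uniform_le_lagrangian_colex[of T k] T kT by linarith
  next
    case True
    obtain V :: "nat set" and E x where V: "finite V" "E \<subseteq> {f. f \<subseteq> V \<and> card f = 3}" "card E \<le> m"
      and x: "\<And>i. i \<in> V \<Longrightarrow> 0 < x i" "(\<Sum>i\<in>V. x i) = 1" "lambda3 m = (\<Sum>f\<in>E. \<Prod>i\<in>f. x i)"
      and link: "\<And>i. i \<in> V \<Longrightarrow> link_weight E x i = 3 * lambda3 m"
      using optimal_weighting_exists[OF m] by blast
    interpret near_clique_optimum V E x "lambda3 m" T
      using V x link True T by unfold_locales auto
    show ?thesis
    proof (cases "card V = T + 1")
      case True
      \<comment> \<open>As \<open>card M\<close> is \<open>O(m powr (1 / 3))\<close>, this
        \<open>h\<close> balances \<open>h * card M\<close> against \<open>1 / h\<^sup>2\<close>;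
        both are of order \<open>m powr (2 / 9)\<close>.\<close>
      define h where "h = real m powr (- 1 / 9)"
      have h: "0 < h" using m by (simp add: h_def)
      have "6 * real (T choose 3) = (real T - 1) ^ 3 - (real T - 1)"
        using six_choose_3[of "T - 1"] T(1) by (simp add: of_nat_diff)
      also have "\<dots> = real T * (real T * real T) - 3 * (real T * real T) + 2 * real T"
        by (simp add: algebra_simps power3_eq_cube)
      finally have "6 * real (T choose 3) = real T * (real T * real T) - 3 * (real T * real T) + 2 * real T" .
      moreover have "10000 * (real T * real T) \<le> real T * (real T * real T)"
        using T(1) by (intro mult_right_mono) auto
      \<comment> \<open>A factor slightly above 6 would do; 8 is a perfect cube, convenient for the
        cube root taken next.\<close>
      moreover have "p \<le> 8 * u" if "6 * v = p - 3 * q + 2 * t" "10000 * q \<le> p" "0 \<le> q" "0 \<le> t" "v < u"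
        for p q t u v :: real using that by linarith
      ultimately have "real T * (real T * real T) \<le> 8 * real m" using T(2) by simp
      hence "real T ^ 3 \<le> (2 * real m powr (1 / 3)) ^ 3"
        using m powr_realpow[of "real m powr (1 / 3)" 3]
        by (simp add: powr_powr power_mult_distrib) (simp add: power3_eq_cube)
      hence "real T \<le> 2 * real m powr (1 / 3)"
        by (metis mult_nonneg_nonneg of_nat_0_le_iff power_mono_iff powr_ge_zero zero_le_numeral zero_less_numeral)
      hence "h * card M \<le> h * (4300 * (2 * real m powr (1 / 3)))"
        using card_M_le h by (intro mult_left_mono) auto
      also have "\<dots> = 8600 * (real m powr (- 1 / 9) * real m powr (1 / 3))" by (simp add: h_def)
      also have "real m powr (- 1 / 9) * real m powr (1 / 3) = real m powr (2 / 9)"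
        by (simp flip: powr_add)
      finally have 1: "h * card M \<le> 8600 * real m powr (2 / 9)" .
      have 2: "120000 ^ 3 / h\<^sup>2 = 120000 ^ 3 * real m powr (2 / 9)"
      proof -
        have "h\<^sup>2 = real m powr - (2 / 9)" using m by (simp add: h_def powr_power)
        thus ?thesis by (simp add: powr_minus_divide)
      qed
      have 3: "1 \<le> real m powr (2 / 9)" using m by (intro ge_one_powr_ge_zero) auto
      \<comment> \<open>The constant 9000 covers the 8600 from \<open>h * card M\<close> and the
        final \<open>+ 1\<close>.\<close>
      have "card E + h * card M + 120000 ^ 3 / h\<^sup>2 + 1 \<le> real k"
        using 1 2 3 k V(3) by (simp add: algebra_simps)
      thus ?thesis by (rule le_lagrangian_colex[OF True h kT])
    next
      case False
      hence "card V \<le> T" using card_V_le by simp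
      hence "card V choose 3 \<le> k" using kT binomial_right_mono order_trans by blast
      moreover have "3 \<le> card V"
      proof -
        have "E \<noteq> {}" using x(3) lambda3_pos[OF m] by auto
        then obtain f where "f \<subseteq> V" "card f = 3" using V(2) by blast
        thus ?thesis using card_mono[OF V(1)] by metis
      qed
      ultimately have "esym 3 V x \<le> lagrangian (colex_graph k)"
        using V x nonneg by (intro esym_3_le_lagrangian_colex) auto
      thus ?thesis using w_le_esym by simp
    qed
  qed
qed

theorem theorem1p8:
  shows "\<exists>c::real. c > 0 \<and> (\<forall>m::nat. m > 0 \<longrightarrow>
    lambda3 m \<le> lagrangian (colex_graph (nat \<lfloor>real m + c * real m powr (2 / 9)\<rfloor>)))"
proof -
  define N where "N = (10000::nat) choose 3"
  define K where "K = (3 * N) choose 3"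
  \<comment> \<open>\<open>K\<close> settles the case \<open>m \<le> N\<close>; the excess of 9001
    over 9000 pays for the floor.\<close>
  define c where "c = 9001 + 120000 ^ 3 + real K"
  have "lambda3 m \<le> lagrangian (colex_graph (nat \<lfloor>real m + c * real m powr (2 / 9)\<rfloor>))" if m: "m > 0" for m
  proof -
    define k where "k = nat \<lfloor>real m + c * real m powr (2 / 9)\<rfloor>"
    have p: "1 \<le> real m powr (2 / 9)" using m by (intro ge_one_powr_ge_zero) auto
    have k: "real m + c * real m powr (2 / 9) - 1 \<le> real k" unfolding k_def by linarith
    have "lambda3 m \<le> lagrangian (colex_graph k)"
    proof (cases "m \<le> N")
      case True
      have "c * 1 \<le> c * real m powr (2 / 9)" using p by (intro mult_left_mono) (auto simp: c_def)
      moreover have "real K \<le> c" by (simp add: c_def)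
      ultimately have "real K \<le> real k" using k m by linarith
      hence "K \<le> k" by simp
      moreover have "(3 * m) choose 3 \<le> K" unfolding K_def using True by (intro binomial_right_mono) auto
      ultimately show ?thesis using m by (intro lambda3_le_colex_trivial) auto
    next
      case False
      \<comment> \<open>\<open>t - 1\<close> will be the \<open>T\<close> of the estimate for large
        \<open>m\<close>; minimality of \<open>t\<close> gives the strict lower bound on
        \<open>m\<close>.\<close>
      define t where "t = (LEAST t. m \<le> t choose 3)"
      have ex: "m \<le> (m + 3) choose 3"
      proof -
        have "n \<le> (n + 3) choose 3" for n :: nat
        proof (induction n)
          case (Suc n)
          have "0 < (n + 3) choose 2" by simp
          moreover have "(Suc n + 3) choose 3 = ((n + 3) choose 2) + ((n + 3) choose 3)"
            by (simp add: numeral_3_eq_3 numeral_2_eq_2)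
          ultimately show ?case using Suc by linarith
        qed simp
        thus ?thesis .
      qed
      have t: "m \<le> t choose 3" unfolding t_def by (rule LeastI[of _ "m + 3"]) (rule ex)
      have less: "s choose 3 < m" if "s < t" for s
        using not_less_Least[of s "\<lambda>t. m \<le> t choose 3"] that unfolding t_def by simp
      have "10000 < t"
      proof (rule ccontr)
        assume "\<not> ?thesis"
        hence "t choose 3 \<le> N" unfolding N_def by (intro binomial_right_mono) auto
        thus False using t False by simp
      qed
      moreover have "real m + (9000 + 120000 ^ 3) * real m powr (2 / 9) \<le> real k"
      proof -
        have "0 \<le> real K * real m powr (2 / 9)" by simp
        hence "(9000 + 120000 ^ 3) * real m powr (2 / 9) + 1 \<le> c * real m powr (2 / 9)"
          using p unfolding c_def distrib_right by linarith
        thus ?thesis using k by linarith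
      qed
      ultimately show ?thesis using t less[of "t - 1"]
        by (intro lambda3_le_colex_large[of "t - 1"]) auto
    qed
    thus ?thesis unfolding k_def .
  qed
  moreover have "c > 0" by (simp add: c_def)
  ultimately show ?thesis by blast
qed

end
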